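(* Let $\mathbf V$ be a congruence-modular variety of algebras and let $A\in\mathbf V$. Then the lattice $\operatorname{SupUnif} A$ of compatible superuniformities on $A$, ordered by inclusion, is modular.
   Context: For a set $S$, $\operatorname{Rel} S$ is the complete lattice of all binary relations on $S$, ordered by inclusion. A filter of relations on $S$ is a nonempty subset of $\operatorname{Rel} S$ closed upward and under binary intersections (the improper filter is allowed). $\operatorname{Fil}\operatorname{Rel} S$ is the complete lattice of such filters ordered by REVERSE inclusion: $\mathcal F\le\mathcal G$ iff $\mathcal F\supseteq\mathcal G$; thus joins of filters are intersections and the meet of a family is the filter generated by its union. $\operatorname{Fg} X$ is the filter generated by a nonempty set $X$ of relations. An ideal of a lattice is a nonempty subset closed downward and under binary joins; $\operatorname{Idl}\operatorname{Fil}\operatorname{Rel} S$ is the set of ideals of $\operatorname{Fil}\operatorname{Rel} S$, ordered by inclusion, and $\operatorname{Ig} X$ is the ideal generated by a nonempty set $X$ of filters. Composition of relations: $a\,(R\circ R')\,c$ iff there is $b$ with $a\,R\,b$ and $b\,R'\,c$. For filters, $\mathcal F\circ\mathcal F'=\operatorname{Fg}\{R\circ R'\mid R\in\mathcal F,\ R'\in\mathcal F'\}$ and $\mathcal F^{\mathrm{op}}=\{R^{\mathrm{op}}\mid R\in\mathcal F\}$. For ideals of filters, $\mathcal E^{\mathrm{op}}=\{\mathcal F^{\mathrm{op}}\mid\mathcal F\in\mathcal E\}$ and $\mathcal E\circ\mathcal E'=\operatorname{Ig}\{\mathcal F\circ\mathcal F'\mid\mathcal F\in\mathcal E,\ \mathcal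 F'\in\mathcal E'\}$. A superuniformity on $S$ is an $\mathcal E\in\operatorname{Idl}\operatorname{Fil}\operatorname{Rel} S$ such that $\operatorname{Fg}\{\Delta_S\}\in\mathcal E$ (where $\Delta_S$ is the identity relation), $\mathcal E=\mathcal E^{\mathrm{op}}$, and $\mathcal E\circ\mathcal E\subseteq\mathcal E$. Let $A$ be an algebra (its underlying set may be empty). For an $n$-ary operation $w$ and relations $F_1,\ldots,F_n$, put $w(F_1,\ldots,F_n)=\{\langle w(a_1,\ldots,a_n),w(b_1,\ldots,b_n)\rangle\mid\langle a_i,b_i\rangle\in F_i\text{ for all }i\}$, and for filters put $w(\mathcal F_1,\ldots,\mathcal F_n)=\operatorname{Fg}\{w(F_1,\ldots,F_n)\mid F_1\in\mathcal F_1,\ldots,F_n\in\mathcal F_n\}$. A superuniformity $\mathcal E$ on the underlying set of $A$ is compatible if $w(\mathcal F_1,\ldots,\mathcal F_n)\in\mathcal E$ for every $n$, every $n$-ary basic operation $w$ and all $\mathcal F_1,\ldots,\mathcal F_n\in\mathcal E$. $\operatorname{SupUnif} A$ denotes the set of compatible superuniformities on $A$, ordered by inclusion; it is a (complete) lattice. A variety is congruence-modular if every algebra in it has a modular congruence lattice. *)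

theory Defs
  imports "HOL.Hull" "HOL-Algebra.Lattice"
begin

section \<open>Lattices\<close>

definition modular_lattice :: "('a, 'm) gorder_scheme \<Rightarrow> bool" where
  "modular_lattice L \<longleftrightarrow> lattice L \<and>
    (\<forall>x \<in> carrier L. \<forall>y \<in> carrier L. \<forall>z \<in> carrier L.
      x \<sqsubseteq>\<^bsub>L\<^esub> z \<longrightarrow> x \<squnion>\<^bsub>L\<^esub> (y \<sqinter>\<^bsub>L\<^esub> z) = (x \<squnion>\<^bsub>L\<^esub> y) \<sqinter>\<^bsub>L\<^esub> z)"

definition lattice_ideal :: "('a, 'm) gorder_scheme \<Rightarrow> 'a set \<Rightarrow> bool" where
  "lattice_ideal L I \<longleftrightarrow> I \<subseteq> carrier L \<and> I \<noteq> {} \<and>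
    (\<forall>x \<in> I. \<forall>y \<in> carrier L. y \<sqsubseteq>\<^bsub>L\<^esub> x \<longrightarrow> y \<in> I) \<and>
    (\<forall>x \<in> I. \<forall>y \<in> I. x \<squnion>\<^bsub>L\<^esub> y \<in> I)"

definition inclusion_order :: "'a set set \<Rightarrow> 'a set gorder" where
  "inclusion_order C = \<lparr>carrier = C, eq = (=), le = (\<subseteq>)\<rparr>"

definition reverse_inclusion_order :: "'a set set \<Rightarrow> 'a set gorder" where
  "reverse_inclusion_order C = \<lparr>carrier = C, eq = (=), le = (\<supseteq>)\<rparr>"


section \<open>Filters of relations\<close>

text \<open>The underlying set \<open>S\<close> is an arbitrary, possibly empty, set inside a type, and a relation
  on \<open>S\<close> is a subset of \<open>S \<times> S\<close>. The improper filter \<open>Pow (S \<times> S)\<close> is allowed.\<close>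

definition relation_filter :: "'a set \<Rightarrow> 'a rel set \<Rightarrow> bool" where
  "relation_filter S F \<longleftrightarrow> F \<subseteq> Pow (S \<times> S) \<and> F \<noteq> {} \<and>
    (\<forall>R \<in> F. \<forall>R'. R \<subseteq> R' \<and> R' \<subseteq> S \<times> S \<longrightarrow> R' \<in> F) \<and>
    (\<forall>R \<in> F. \<forall>R' \<in> F. R \<inter> R' \<in> F)"

definition Fil_Rel :: "'a set \<Rightarrow> 'a rel set gorder" where
  "Fil_Rel S = reverse_inclusion_order {F. relation_filter S F}"

definition Fg :: "'a set \<Rightarrow> 'a rel set \<Rightarrow> 'a rel set" where
  "Fg S X = relation_filter S hull X"

definition filter_op :: "'a rel set \<Rightarrow> 'a rel set" where
  "filter_op F = converse ` F"

definition filter_comp :: "'a set \<Rightarrow> 'a rel set \<Rightarrow> 'a rel set \<Rightarrow> 'a rel set" where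
  "filter_comp S F F' = Fg S {R O R' | R R'. R \<in> F \<and> R' \<in> F'}"


section \<open>Superuniformities\<close>

definition Ig :: "'a set \<Rightarrow> 'a rel set set \<Rightarrow> 'a rel set set" where
  "Ig S X = lattice_ideal (Fil_Rel S) hull X"

definition ideal_op :: "'a rel set set \<Rightarrow> 'a rel set set" where
  "ideal_op E = filter_op ` E"

definition ideal_comp :: "'a set \<Rightarrow> 'a rel set set \<Rightarrow> 'a rel set set \<Rightarrow> 'a rel set set" where
  "ideal_comp S E E' = Ig S {filter_comp S F F' | F F'. F \<in> E \<and> F' \<in> E'}"

definition superuniformity :: "'a set \<Rightarrow> 'a rel set set \<Rightarrow> bool" where
  "superuniformity S E \<longleftrightarrow> lattice_ideal (Fil_Rel S) E \<and>
    Fg S {Id_on S} \<in> E \<and> E = ideal_op E \<and> ideal_comp S E E \<subseteq> E"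


section \<open>Algebras, congruences and varieties\<close>

text \<open>A signature is an arity function \<open>ar\<close> on the type of its operation symbols. An operation
  takes its arguments as a list; its values at lists that are of the wrong length or not in the
  universe are irrelevant. The universe may be empty.\<close>

record ('f, 'a) algebra =
  universe :: "'a set"
  oper :: "'f \<Rightarrow> 'a list \<Rightarrow> 'a"

definition is_algebra :: "('f \<Rightarrow> nat) \<Rightarrow> ('f, 'a) algebra \<Rightarrow> bool" where
  "is_algebra ar A \<longleftrightarrow>
    (\<forall>f as. length as = ar f \<and> set as \<subseteq> universe A \<longrightarrow> oper A f as \<in> universe A)"

definition congruence :: "('f \<Rightarrow> nat) \<Rightarrow> ('f, 'a) algebra \<Rightarrow> 'a rel \<Rightarrow> bool" where
  "congruence ar A \<theta> \<longleftrightarrow> equiv (universe A) \<theta> \<and>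
    (\<forall>f as bs. length as = ar f \<and> list_all2 (\<lambda>a b. (a, b) \<in> \<theta>) as bs \<longrightarrow>
      (oper A f as, oper A f bs) \<in> \<theta>)"

definition Con :: "('f \<Rightarrow> nat) \<Rightarrow> ('f, 'a) algebra \<Rightarrow> 'a rel gorder" where
  "Con ar A = inclusion_order {\<theta>. congruence ar A \<theta>}"

datatype ('f, 'v) trm = Var 'v | App 'f "('f, 'v) trm list"

fun wf_trm :: "('f \<Rightarrow> nat) \<Rightarrow> ('f, 'v) trm \<Rightarrow> bool" where
  "wf_trm ar (Var x) \<longleftrightarrow> True"
| "wf_trm ar (App f ts) \<longleftrightarrow> length ts = ar f \<and> (\<forall>t \<in> set ts. wf_trm ar t)"

primrec trm_value :: "('f, 'a) algebra \<Rightarrow> ('v \<Rightarrow> 'a) \<Rightarrow> ('f, 'v) trm \<Rightarrow> 'a" where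
  "trm_value A \<nu> (Var x) = \<nu> x"
| "trm_value A \<nu> (App f ts) = oper A f (map (trm_value A \<nu>) ts)"

text \<open>A variety is the class of all algebras of the signature \<open>ar\<close> that satisfy a given set \<open>\<Sigma>\<close> of
  identities in countably many variables. The class is polymorphic in the type of the elements.\<close>

definition identities :: "('f \<Rightarrow> nat) \<Rightarrow> (('f, nat) trm \<times> ('f, nat) trm) set \<Rightarrow> bool" where
  "identities ar \<Sigma> \<longleftrightarrow> (\<forall>(s, t) \<in> \<Sigma>. wf_trm ar s \<and> wf_trm ar t)"

definition variety ::
    "('f \<Rightarrow> nat) \<Rightarrow> (('f, nat) trm \<times> ('f, nat) trm) set \<Rightarrow> ('f, 'a) algebra set" where
  "variety ar \<Sigma> = {A. is_algebra ar A \<and>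
    (\<forall>(s, t) \<in> \<Sigma>. \<forall>\<nu>. range \<nu> \<subseteq> universe A \<longrightarrow> trm_value A \<nu> s = trm_value A \<nu> t)}"

text \<open>HOL cannot quantify over types inside a formula, so the type \<open>'b\<close> of the elements of the
  algebras ranged over is a parameter. For \<open>'b = ('f, nat) trm set\<close> the condition covers, up to
  isomorphism, all algebras in the variety with at most as many elements as there are sets of
  terms, in particular the free algebra on countably many generators (whose elements are classes
  of terms). Every instance is implied by congruence modularity in the usual sense, so
  assuming one instance only is at most a weaker hypothesis.\<close>

definition congruence_modular ::
    "'b itself \<Rightarrow> ('f \<Rightarrow> nat) \<Rightarrow> (('f, nat) trm \<times> ('f, nat) trm) set \<Rightarrow> bool" where
  "congruence_modular _ ar \<Sigma> \<longleftrightarrow>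
    (\<forall>B :: ('f, 'b) algebra. B \<in> variety ar \<Sigma> \<longrightarrow> modular_lattice (Con ar B))"


section \<open>Compatible superuniformities\<close>

text \<open>Below, the arity \<open>n\<close> of the operation symbol is the length of the list of relations or
  filters.\<close>

definition rel_oper :: "('f, 'a) algebra \<Rightarrow> 'f \<Rightarrow> 'a rel list \<Rightarrow> 'a rel" where
  "rel_oper A f Rs = {(oper A f as, oper A f bs) | as bs.
    length as = length Rs \<and> length bs = length Rs \<and>
    (\<forall>i < length Rs. (as ! i, bs ! i) \<in> Rs ! i)}"

definition filter_oper :: "('f, 'a) algebra \<Rightarrow> 'f \<Rightarrow> 'a rel set list \<Rightarrow> 'a rel set" where
  "filter_oper A f Fs = Fg (universe A) {rel_oper A f Rs | Rs. list_all2 (\<in>) Rs Fs}"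

definition compatible :: "('f \<Rightarrow> nat) \<Rightarrow> ('f, 'a) algebra \<Rightarrow> 'a rel set set \<Rightarrow> bool" where
  "compatible ar A E \<longleftrightarrow>
    (\<forall>f Fs. length Fs = ar f \<and> set Fs \<subseteq> E \<longrightarrow> filter_oper A f Fs \<in> E)"

definition SupUnif :: "('f \<Rightarrow> nat) \<Rightarrow> ('f, 'a) algebra \<Rightarrow> 'a rel set set gorder" where
  "SupUnif ar A = inclusion_order {E. superuniformity (universe A) E \<and> compatible ar A E}"

end

theory Submission
  imports Defs
begin

text \<open>A compatible superuniformity \<open>E\<close> on \<open>A\<close> becomes an ordinary congruence when the points of \<open>A\<close> are
  replaced by generalised points. Let \<open>\<Phi>\<close> be a filter on an index type \<open>I\<close>, and call two families
  \<open>p, q : I \<rightarrow> A\<close> related if the filter of all relations \<open>R\<close> such that \<open>(p i, q i) \<in> R\<close> holds eventually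
  along \<open>\<Phi>\<close> is a member of \<open>E\<close>. This is a congruence of the power of \<open>A\<close> with exponent \<open>I\<close>
  (\<open>congruence_induced_rel\<close>), it depends on \<open>E\<close> monotonically, and it turns intersections into
  intersections. The power belongs to the variety, so the modular law holds for its congruences
  (\<open>modular_law_for_congruences\<close>).

  Meets of compatible superuniformities are intersections, and each filter in the join of \<open>\<alpha>\<close> and
  \<open>\<beta>\<close> is below a finite composition \<open>F \<circ> F' \<circ> \<dots> \<circ> F \<circ> F'\<close> with \<open>F \<in> \<alpha>\<close> and \<open>F' \<in> \<beta>\<close>. Such a
  filter \<open>G\<close> is turned into a pair of generalised points: let \<open>I\<close> consist of the chains of elements, with
  the filter generated by \<open>F\<close>, \<open>F'\<close> and \<open>G\<close>. The coordinates of the chain are families that are linked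
  by steps of the congruences induced by \<open>\<alpha>\<close> and \<open>\<beta>\<close>, and the filter of relations between the first
  and the last one is \<open>G\<close> (\<open>chain_filters_realised\<close>). If \<open>\<alpha> \<subseteq> \<gamma>\<close> and \<open>G \<in> \<gamma>\<close>, the modular law
  for the induced congruences shows that the ends are related by the congruence that the join of \<open>\<alpha>\<close>
  and \<open>\<beta> \<inter> \<gamma>\<close> induces, that is, \<open>G\<close> belongs to this join.

  Congruence modularity is assumed for algebras whose elements are sets of terms, and the power of \<open>A\<close>
  need not be of this kind. The modular law reaches it through the free algebra, where it is applied to
  three congruences that identify generators: the finitely many elements of a chain are the values of
  a valuation, and evaluation pulls the congruences of the power back to the free algebra.\<close>

section \<open>Lattices of sets\<close>

lemma inclusion_lattice_join:
  assumes "lattice (inclusion_order C)" "x \<in> C" "y \<in> C"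
  defines "j \<equiv> x \<squnion>\<^bsub>inclusion_order C\<^esub> y"
  shows "j \<in> C" "x \<subseteq> j" "y \<subseteq> j" "\<And>z. z \<in> C \<Longrightarrow> x \<subseteq> z \<Longrightarrow> y \<subseteq> z \<Longrightarrow> j \<subseteq> z"
proof -
  interpret lattice "inclusion_order C" by fact
  show "j \<in> C" "x \<subseteq> j" "y \<subseteq> j" "\<And>z. z \<in> C \<Longrightarrow> x \<subseteq> z \<Longrightarrow> y \<subseteq> z \<Longrightarrow> j \<subseteq> z"
    using join_closed[of x y] join_left[of x y] join_right[of x y] join_le[of x _ y] assms(2,3)
    unfolding j_def by (simp_all add: inclusion_order_def)
qed

lemma inclusion_lattice_meet:
  assumes "lattice (inclusion_order C)" "x \<in> C" "y \<in> C" "x \<inter> y \<in> C"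
  shows "x \<sqinter>\<^bsub>inclusion_order C\<^esub> y = x \<inter> y"
proof -
  interpret lattice "inclusion_order C" by fact
  show ?thesis
    using meet_left[of x y] meet_right[of x y] meet_le[of "x \<inter> y" x y] assms(2-4)
    by (auto simp: inclusion_order_def)
qed

text \<open>The join of two members is the intersection of all their common upper bounds; the top
  element makes this family nonempty.\<close>

lemma lattice_inclusion_order:
  assumes top: "T \<in> C" "\<And>x. x \<in> C \<Longrightarrow> x \<subseteq> T"
    and Inter: "\<And>X. X \<subseteq> C \<Longrightarrow> X \<noteq> {} \<Longrightarrow> \<Inter>X \<in> C"
  shows "lattice (inclusion_order C)"
proof -
  interpret partial_order "inclusion_order C"
    by unfold_locales (auto simp: inclusion_order_def)
  show ?thesis
  proof unfold_locales
    fix x y assume "x \<in> carrier (inclusion_order C)" "y \<in> carrier (inclusion_order C)"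
    then have xy: "x \<in> C" "y \<in> C" by (simp_all add: inclusion_order_def)
    then have "\<Inter>{z \<in> C. x \<subseteq> z \<and> y \<subseteq> z} \<in> C" using top by (intro Inter) auto
    then show "\<exists>s. least (inclusion_order C) s (Upper (inclusion_order C) {x, y})"
      using xy
      by (intro exI[of _ "\<Inter>{z \<in> C. x \<subseteq> z \<and> y \<subseteq> z}"])
        (auto simp: least_def Upper_def inclusion_order_def)
    have "x \<inter> y \<in> C" using Inter[of "{x, y}"] xy by simp
    then show "\<exists>s. greatest (inclusion_order C) s (Lower (inclusion_order C) {x, y})"
      using xy by (intro exI[of _ "x \<inter> y"])
        (auto simp: greatest_def Lower_def inclusion_order_def)
  qed
qed

section \<open>Equational logic and the free algebra\<close>

fun subst :: "('v \<Rightarrow> ('f, 'w) trm) \<Rightarrow> ('f, 'v) trm \<Rightarrow> ('f, 'w) trm" where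
  "subst \<sigma> (Var x) = \<sigma> x"
| "subst \<sigma> (App f ts) = App f (map (subst \<sigma>) ts)"

lemma wf_trm_subst: "wf_trm ar t \<Longrightarrow> (\<And>x. wf_trm ar (\<sigma> x)) \<Longrightarrow> wf_trm ar (subst \<sigma> t)"
  by (induction t) auto

lemma subst_subst: "subst \<sigma> (subst \<tau> t) = subst (\<lambda>x. subst \<sigma> (\<tau> x)) t"
  by (induction t) auto

lemma trm_value_subst: "trm_value A \<nu> (subst \<sigma> t) = trm_value A (\<lambda>x. trm_value A \<nu> (\<sigma> x)) t"
proof (induction t)
  case (App f ts)
  then have "map (trm_value A \<nu>) (map (subst \<sigma>) ts) =
    map (trm_value A (\<lambda>x. trm_value A \<nu> (\<sigma> x))) ts" by simp
  then show ?case by (simp del: map_map)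
qed simp

lemma trm_value_in_universe:
  assumes "is_algebra ar A" "wf_trm ar t" "\<And>x. \<nu> x \<in> universe A"
  shows "trm_value A \<nu> t \<in> universe A"
  using assms(2)
proof (induction t)
  case (App f ts)
  then have "set (map (trm_value A \<nu>) ts) \<subseteq> universe A" by auto
  with App.prems show ?case using assms(1) by (simp add: is_algebra_def)
qed (use assms in simp)

text \<open>A syntactic form of equational consequence is used, because the semantic one would quantify over
  algebras of all types.\<close>

inductive derivable ::
    "('f \<Rightarrow> nat) \<Rightarrow> (('f, nat) trm \<times> ('f, nat) trm) set \<Rightarrow> ('f, nat) trm \<Rightarrow> ('f, nat) trm \<Rightarrow> bool"
  for ar \<Sigma> where
  identity: "(s, t) \<in> \<Sigma> \<Longrightarrow> (\<And>x. wf_trm ar (\<sigma> x)) \<Longrightarrow> derivable ar \<Sigma> (subst \<sigma> s) (subst \<sigma> t)"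
| refl: "wf_trm ar t \<Longrightarrow> derivable ar \<Sigma> t t"
| sym: "derivable ar \<Sigma> s t \<Longrightarrow> derivable ar \<Sigma> t s"
| trans: "derivable ar \<Sigma> s t \<Longrightarrow> derivable ar \<Sigma> t u \<Longrightarrow> derivable ar \<Sigma> s u"
| app: "length ss = ar f \<Longrightarrow> list_all2 (derivable ar \<Sigma>) ss ts \<Longrightarrow>
    derivable ar \<Sigma> (App f ss) (App f ts)"

lemma derivable_wf:
  assumes "identities ar \<Sigma>" "derivable ar \<Sigma> s t"
  shows "wf_trm ar s \<and> wf_trm ar t"
  using assms(2)
proof induction
  case (identity s t \<sigma>)
  then show ?case using assms(1) by (auto simp: identities_def intro!: wf_trm_subst)
next
  case (app ss f ts)
  then show ?case by (auto simp: list_all2_conv_all_nth in_set_conv_nth)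
qed auto

lemma derivable_subst:
  assumes "derivable ar \<Sigma> s t" and \<sigma>: "\<And>x. wf_trm ar (\<sigma> x)"
  shows "derivable ar \<Sigma> (subst \<sigma> s) (subst \<sigma> t)"
  using assms(1)
proof induction
  case (identity s t \<tau>)
  then show ?case unfolding subst_subst by (intro derivable.identity wf_trm_subst \<sigma>)
next
  case (app ss f ts)
  then show ?case by (auto intro!: derivable.app simp: list_all2_conv_all_nth)
qed (auto intro: derivable.refl derivable.sym derivable.trans wf_trm_subst \<sigma>)

lemma derivable_sound:
  assumes A: "A \<in> variety ar \<Sigma>" and "derivable ar \<Sigma> s t" and \<nu>: "\<And>x. \<nu> x \<in> universe A"
    and ids: "identities ar \<Sigma>"
  shows "trm_value A \<nu> s = trm_value A \<nu> t"
  using assms(2)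
proof induction
  case (identity s t \<sigma>)
  have "range (\<lambda>x. trm_value A \<nu> (\<sigma> x)) \<subseteq> universe A"
    using A identity \<nu> by (auto simp: variety_def intro!: trm_value_in_universe)
  with identity A show ?case by (force simp: trm_value_subst variety_def)
next
  case (app ss f ts)
  then have "map (trm_value A \<nu>) ss = map (trm_value A \<nu>) ts"
    by (auto simp: list_all2_conv_all_nth intro!: nth_equalityI)
  then show ?case by simp
qed auto

definition term_class ::
    "('f \<Rightarrow> nat) \<Rightarrow> (('f, nat) trm \<times> ('f, nat) trm) set \<Rightarrow> ('f, nat) trm \<Rightarrow> ('f, nat) trm set" where
  "term_class ar \<Sigma> t = {s. derivable ar \<Sigma> t s}"

definition representative :: "'t set \<Rightarrow> 't" where
  "representative C = (SOME t. t \<in> C)"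

text \<open>The free algebra on countably many generators consists of the classes of terms modulo derivable
  equality; its operations are computed on chosen representatives.\<close>

definition free_algebra ::
    "('f \<Rightarrow> nat) \<Rightarrow> (('f, nat) trm \<times> ('f, nat) trm) set \<Rightarrow> ('f, ('f, nat) trm set) algebra" where
  "free_algebra ar \<Sigma> = \<lparr>universe = term_class ar \<Sigma> ` {t. wf_trm ar t},
    oper = (\<lambda>f Cs. term_class ar \<Sigma> (App f (map representative Cs)))\<rparr>"

lemma term_class_eq_iff:
  assumes "wf_trm ar t"
  shows "term_class ar \<Sigma> s = term_class ar \<Sigma> t \<longleftrightarrow> derivable ar \<Sigma> s t"
  using assms unfolding term_class_def
  by (auto intro: derivable.intros(2-4))

lemma derivable_representative:
  assumes "wf_trm ar t"
  shows "derivable ar \<Sigma> t (representative (term_class ar \<Sigma> t))"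
  using someI[of "\<lambda>s. s \<in> term_class ar \<Sigma> t" t] assms
  by (simp add: term_class_def representative_def derivable.refl)

lemma representative_in_free_algebra:
  assumes "identities ar \<Sigma>" "C \<in> universe (free_algebra ar \<Sigma>)"
  shows "wf_trm ar (representative C)" "term_class ar \<Sigma> (representative C) = C"
proof -
  obtain t where t: "wf_trm ar t" "C = term_class ar \<Sigma> t"
    using assms(2) by (auto simp: free_algebra_def)
  note d = derivable_representative[OF t(1), of \<Sigma>]
  show "wf_trm ar (representative C)" using derivable_wf[OF assms(1) d] t by simp
  show "term_class ar \<Sigma> (representative C) = C"
    unfolding t(2) by (rule iffD2[OF term_class_eq_iff[OF t(1)] derivable.sym[OF d]])
qed

lemma free_algebra_is_algebra:
  assumes "identities ar \<Sigma>"
  shows "is_algebra ar (free_algebra ar \<Sigma>)"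
  unfolding is_algebra_def
proof (intro allI impI)
  fix f Cs assume Cs: "length Cs = ar f \<and> set Cs \<subseteq> universe (free_algebra ar \<Sigma>)"
  then have "wf_trm ar (App f (map representative Cs))"
    using representative_in_free_algebra(1)[OF assms] by auto
  then show "oper (free_algebra ar \<Sigma>) f Cs \<in> universe (free_algebra ar \<Sigma>)"
    by (simp add: free_algebra_def del: wf_trm.simps)
qed

lemma oper_free_algebra:
  assumes "identities ar \<Sigma>" "length ts = ar f" "\<forall>t \<in> set ts. wf_trm ar t"
  shows "oper (free_algebra ar \<Sigma>) f (map (term_class ar \<Sigma>) ts) = term_class ar \<Sigma> (App f ts)"
proof -
  have "derivable ar \<Sigma> (App f (map (representative \<circ> term_class ar \<Sigma>) ts)) (App f ts)"
    using assms
    by (auto intro!: derivable.app derivable.sym[OF derivable_representative]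
        simp: list_all2_conv_all_nth)
  then show ?thesis
    using assms by (simp add: free_algebra_def term_class_eq_iff)
qed

lemma trm_value_free_algebra:
  assumes "identities ar \<Sigma>" "wf_trm ar t" "\<And>x. wf_trm ar (\<sigma> x)"
  shows "trm_value (free_algebra ar \<Sigma>) (\<lambda>x. term_class ar \<Sigma> (\<sigma> x)) t = term_class ar \<Sigma> (subst \<sigma> t)"
  using assms(2)
proof (induction t)
  case (App f ts)
  then have *: "map (trm_value (free_algebra ar \<Sigma>) (\<lambda>x. term_class ar \<Sigma> (\<sigma> x))) ts =
    map (term_class ar \<Sigma>) (map (subst \<sigma>) ts)" by simp
  show ?case
    using App.prems unfolding trm_value.simps *
    by (subst oper_free_algebra) (auto simp: assms intro!: wf_trm_subst)
qed simp

lemma free_algebra_in_variety: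
  assumes "identities ar \<Sigma>"
  shows "free_algebra ar \<Sigma> \<in> variety ar \<Sigma>"
proof -
  have "trm_value (free_algebra ar \<Sigma>) \<nu> s = trm_value (free_algebra ar \<Sigma>) \<nu> t"
    if st: "(s, t) \<in> \<Sigma>" and \<nu>: "range \<nu> \<subseteq> universe (free_algebra ar \<Sigma>)" for s t \<nu>
  proof -
    define \<sigma> where "\<sigma> x = representative (\<nu> x)" for x
    have \<sigma>: "wf_trm ar (\<sigma> x)" "term_class ar \<Sigma> (\<sigma> x) = \<nu> x" for x
      using representative_in_free_algebra[OF assms, of "\<nu> x"] \<nu> by (auto simp: \<sigma>_def)
    have wf: "wf_trm ar s" "wf_trm ar t" using assms st by (auto simp: identities_def)
    have "term_class ar \<Sigma> (subst \<sigma> s) = term_class ar \<Sigma> (subst \<sigma> t)"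
      using wf \<sigma> st by (simp add: term_class_eq_iff wf_trm_subst derivable.identity)
    then show ?thesis
      using trm_value_free_algebra[where \<sigma> = \<sigma>, OF assms _ \<sigma>(1)] wf by (simp add: \<sigma>(2))
  qed
  then show ?thesis using free_algebra_is_algebra[OF assms] by (auto simp: variety_def)
qed

section \<open>The modular law for congruences of all algebras of the variety\<close>

text \<open>The pullback of \<open>\<theta>\<close> along the homomorphism from the free algebra to \<open>B\<close> that extends the
  valuation \<open>\<nu>\<close>. Pullbacks carry both directions of the argument: the congruences of the free
  algebra to which modularity is applied are pullbacks of equality along endomorphisms, and the
  congruence of \<open>B\<close> in which the conclusion is sought is pulled back to receive the result.\<close>

definition evaluation_kernel ::
    "('f \<Rightarrow> nat) \<Rightarrow> (('f, nat) trm \<times> ('f, nat) trm) set \<Rightarrow> ('f, 'b) algebra \<Rightarrow> (nat \<Rightarrow> 'b) \<Rightarrow> 'b rel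
      \<Rightarrow> ('f, nat) trm set rel" where
  "evaluation_kernel ar \<Sigma> B \<nu> \<theta> = {(term_class ar \<Sigma> s, term_class ar \<Sigma> t) | s t.
     wf_trm ar s \<and> wf_trm ar t \<and> (trm_value B \<nu> s, trm_value B \<nu> t) \<in> \<theta>}"

text \<open>By soundness, the values of terms depend only on their classes, so membership can be tested on
  any representatives.\<close>

lemma evaluation_kernel_iff:
  assumes ids: "identities ar \<Sigma>" and B: "B \<in> variety ar \<Sigma>" and \<nu>: "\<And>x. \<nu> x \<in> universe B"
    and wf: "wf_trm ar s" "wf_trm ar t"
  shows "(term_class ar \<Sigma> s, term_class ar \<Sigma> t) \<in> evaluation_kernel ar \<Sigma> B \<nu> \<theta> \<longleftrightarrow>
    (trm_value B \<nu> s, trm_value B \<nu> t) \<in> \<theta>"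
proof -
  have "trm_value B \<nu> u = trm_value B \<nu> u'"
    if "wf_trm ar u'" "term_class ar \<Sigma> u = term_class ar \<Sigma> u'" for u u'
    using derivable_sound[OF B _ \<nu> ids] that by (simp add: term_class_eq_iff)
  then show ?thesis using wf unfolding evaluation_kernel_def by (smt (verit) mem_Collect_eq prod.inject)
qed

lemma congruence_evaluation_kernel:
  assumes ids: "identities ar \<Sigma>" and B: "B \<in> variety ar \<Sigma>" and \<nu>: "\<And>x. \<nu> x \<in> universe B"
    and \<theta>: "congruence ar B \<theta>"
  shows "congruence ar (free_algebra ar \<Sigma>) (evaluation_kernel ar \<Sigma> B \<nu> \<theta>)" (is "congruence ar ?F ?K")
proof -
  note iff = evaluation_kernel_iff[OF ids B \<nu>]
  have alg: "is_algebra ar B" using B by (simp add: variety_def)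
  have eq: "equiv (universe B) \<theta>" using \<theta> by (simp add: congruence_def)
  have univ: "universe ?F = term_class ar \<Sigma> ` {t. wf_trm ar t}" by (simp add: free_algebra_def)
  have K: "\<exists>s t. C = term_class ar \<Sigma> s \<and> C' = term_class ar \<Sigma> t \<and> wf_trm ar s \<and> wf_trm ar t \<and>
     (trm_value B \<nu> s, trm_value B \<nu> t) \<in> \<theta>" if "(C, C') \<in> ?K" for C C'
    using that by (auto simp: evaluation_kernel_def)
  have "equiv (universe ?F) ?K"
  proof (rule equivI)
    show "?K \<subseteq> universe ?F \<times> universe ?F" by (auto simp: univ evaluation_kernel_def)
    show "refl_on (universe ?F) ?K"
    proof (rule refl_onI)
      fix C assume "C \<in> universe ?F"
      then obtain t where t: "wf_trm ar t" "C = term_class ar \<Sigma> t" by (auto simp: univ)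
      have "(trm_value B \<nu> t, trm_value B \<nu> t) \<in> \<theta>"
        using eq trm_value_in_universe[OF alg t(1) \<nu>] by (meson equivE refl_onD)
      with t show "(C, C) \<in> ?K" by (simp add: iff)
    qed
    show "sym ?K"
    proof (rule symI)
      fix C D assume "(C, D) \<in> ?K"
      moreover have "sym \<theta>" using eq by (auto elim: equivE)
      ultimately show "(D, C) \<in> ?K" by (auto simp: iff dest!: K dest: symD)
    qed
    show "trans ?K"
    proof (rule transI)
      fix C C' C'' assume "(C, C') \<in> ?K" "(C', C'') \<in> ?K"
      from K[OF this(1)] K[OF this(2)] obtain s t s' t' where
        st: "C = term_class ar \<Sigma> s" "C' = term_class ar \<Sigma> t" "wf_trm ar s" "wf_trm ar t"
          "(trm_value B \<nu> s, trm_value B \<nu> t) \<in> \<theta>"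
          "C' = term_class ar \<Sigma> s'" "C'' = term_class ar \<Sigma> t'" "wf_trm ar s'" "wf_trm ar t'"
          "(trm_value B \<nu> s', trm_value B \<nu> t') \<in> \<theta>" by blast
      have "derivable ar \<Sigma> t s'" using st(2,6,8) term_class_eq_iff[of ar s' \<Sigma> t] by simp
      then have "trm_value B \<nu> t = trm_value B \<nu> s'" by (intro derivable_sound[OF B _ \<nu> ids])
      moreover have "trans \<theta>" using eq by (auto elim: equivE)
      ultimately have "(trm_value B \<nu> s, trm_value B \<nu> t') \<in> \<theta>" using st by (metis transD)
      with st show "(C, C'') \<in> ?K" by (simp add: iff)
    qed
  qed
  moreover have "(oper ?F f Cs, oper ?F f Ds) \<in> ?K"
    if len: "length Cs = ar f" and CD: "list_all2 (\<lambda>C D. (C, D) \<in> ?K) Cs Ds" for f Cs Ds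
  proof -
    have CD': "length Ds = length Cs" "(Cs ! i, Ds ! i) \<in> ?K" if "i < length Cs" for i
      using CD that by (auto simp: list_all2_conv_all_nth)
    have lenD: "length Ds = length Cs" using CD by (simp add: list_all2_lengthD)
    from CD'(2) have "\<forall>i<length Cs. \<exists>s t. Cs ! i = term_class ar \<Sigma> s \<and> Ds ! i = term_class ar \<Sigma> t \<and>
      wf_trm ar s \<and> wf_trm ar t \<and> (trm_value B \<nu> s, trm_value B \<nu> t) \<in> \<theta>" using K by blast
    then obtain s t where st: "\<And>i. i < length Cs \<Longrightarrow> Cs ! i = term_class ar \<Sigma> (s i) \<and>
      Ds ! i = term_class ar \<Sigma> (t i) \<and> wf_trm ar (s i) \<and> wf_trm ar (t i) \<and>
      (trm_value B \<nu> (s i), trm_value B \<nu> (t i)) \<in> \<theta>" by metis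
    let ?ss = "map s [0..<length Cs]" and ?ts = "map t [0..<length Cs]"
    have Cs: "Cs = map (term_class ar \<Sigma>) ?ss" "Ds = map (term_class ar \<Sigma>) ?ts"
      using st lenD by (auto intro: nth_equalityI)
    have wf: "wf_trm ar (App f ?ss)" "wf_trm ar (App f ?ts)" using st len by auto
    have "(oper B f (map (trm_value B \<nu>) ?ss), oper B f (map (trm_value B \<nu>) ?ts)) \<in> \<theta>"
      using \<theta> st len by (auto simp: congruence_def list_all2_conv_all_nth)
    then have "(term_class ar \<Sigma> (App f ?ss), term_class ar \<Sigma> (App f ?ts)) \<in> ?K"
      using wf by (subst iff) (simp_all del: map_map)
    moreover have "oper ?F f (map (term_class ar \<Sigma>) ?ss) = term_class ar \<Sigma> (App f ?ss)"
      "oper ?F f (map (term_class ar \<Sigma>) ?ts) = term_class ar \<Sigma> (App f ?ts)"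
      by (rule oper_free_algebra[OF ids]; use st len in simp)+
    ultimately show ?thesis unfolding Cs[symmetric] by simp
  qed
  ultimately show ?thesis by (simp add: congruence_def)
qed

lemma congruence_equality:
  assumes "is_algebra ar B"
  shows "congruence ar B (Id_on (universe B))"
proof -
  have "equiv (universe B) (Id_on (universe B))"
    by (auto intro!: equivI simp: refl_on_def sym_def trans_def)
  moreover have "as = bs \<and> set as \<subseteq> universe B"
    if "list_all2 (\<lambda>a b. (a, b) \<in> Id_on (universe B)) as bs" for as bs
    using that by (induction rule: list_all2_induct) auto
  ultimately show ?thesis using assms unfolding congruence_def is_algebra_def
    by (metis Id_onI)
qed

lemma congruence_trm_value:
  assumes \<theta>: "congruence ar B \<theta>" and "wf_trm ar t" and "\<And>x. (\<nu> x, \<nu>' x) \<in> \<theta>"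
  shows "(trm_value B \<nu> t, trm_value B \<nu>' t) \<in> \<theta>"
  using assms(2)
proof (induction t)
  case (App f ts)
  then have "list_all2 (\<lambda>a b. (a, b) \<in> \<theta>) (map (trm_value B \<nu>) ts) (map (trm_value B \<nu>') ts)"
    by (auto simp: list_all2_conv_all_nth)
  with App.prems \<theta> show ?case by (simp add: congruence_def)
qed (use assms in simp)

lemma congruence_Int:
  assumes "congruence ar B \<theta>" "congruence ar B \<eta>"
  shows "congruence ar B (\<theta> \<inter> \<eta>)"
proof -
  have "equiv (universe B) (\<theta> \<inter> \<eta>)"
  proof (rule equivI)
    show "refl_on (universe B) (\<theta> \<inter> \<eta>)"
      using refl_on_Int[of "universe B" \<theta> "universe B" \<eta>] assms
      by (auto simp: congruence_def equiv_def)
  qed (use assms in \<open>auto simp: congruence_def equiv_def intro: sym_Int trans_Int\<close>)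
  moreover have "list_all2 (\<lambda>a b. (a, b) \<in> \<theta>) as bs \<and> list_all2 (\<lambda>a b. (a, b) \<in> \<eta>) as bs"
    if "list_all2 (\<lambda>a b. (a, b) \<in> \<theta> \<inter> \<eta>) as bs" for as bs
    using that by (auto elim: list_all2_mono)
  ultimately show ?thesis using assms unfolding congruence_def by blast
qed

text \<open>If \<open>P x\<close> says that \<open>x\<close> and \<open>Suc x\<close> are linked, the linked numbers form blocks of consecutive
  numbers, and \<open>block_start P\<close> is the retraction of each block to its least element.\<close>

fun block_start :: "(nat \<Rightarrow> bool) \<Rightarrow> nat \<Rightarrow> nat" where
  "block_start P 0 = 0"
| "block_start P (Suc x) = (if P x then block_start P x else Suc x)"

lemma block_start_idem [simp]: "block_start P (block_start P x) = block_start P x"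
  by (induction x) auto

lemma related_block_start:
  assumes "equiv S \<theta>" "\<And>x. \<nu> x \<in> S"
  shows "(\<nu> x, \<nu> (block_start (\<lambda>x. (\<nu> x, \<nu> (Suc x)) \<in> \<theta>) x)) \<in> \<theta>"
proof -
  have r: "(\<nu> x, \<nu> x) \<in> \<theta>" for x using assms by (meson equivE refl_onD)
  have t: "(a, c) \<in> \<theta>" if "(b, a) \<in> \<theta>" "(b, c) \<in> \<theta>" for a b c
    using that assms(1) by (meson equivE symD transD)
  show ?thesis
  proof (induction x)
    case (Suc x)
    then show ?case using t[OF _ Suc] r by auto
  qed (simp add: r)
qed

text \<open>The kernel of the endomorphism of the free algebra that renames the generators by \<open>e\<close>. If \<open>e\<close> is
  a retraction, this is the congruence generated by the pairs of generators \<open>x\<close> and \<open>e x\<close>; a kernel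
  has the advantage that membership is a single derivable identity.\<close>

definition renaming_kernel ::
    "('f \<Rightarrow> nat) \<Rightarrow> (('f, nat) trm \<times> ('f, nat) trm) set \<Rightarrow> (nat \<Rightarrow> nat) \<Rightarrow> ('f, nat) trm set rel" where
  "renaming_kernel ar \<Sigma> e = evaluation_kernel ar \<Sigma> (free_algebra ar \<Sigma>)
     (\<lambda>x. term_class ar \<Sigma> (Var (e x))) (Id_on (universe (free_algebra ar \<Sigma>)))"

lemma term_class_in_free_algebra: "wf_trm ar t \<Longrightarrow> term_class ar \<Sigma> t \<in> universe (free_algebra ar \<Sigma>)"
  by (simp add: free_algebra_def)

lemma renaming_kernel_iff:
  assumes ids: "identities ar \<Sigma>" and wf: "wf_trm ar s" "wf_trm ar t"
  shows "(term_class ar \<Sigma> s, term_class ar \<Sigma> t) \<in> renaming_kernel ar \<Sigma> e \<longleftrightarrow>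
    derivable ar \<Sigma> (subst (\<lambda>x. Var (e x)) s) (subst (\<lambda>x. Var (e x)) t)"
  unfolding renaming_kernel_def
  using wf
  by (subst evaluation_kernel_iff[OF ids free_algebra_in_variety[OF ids]])
    (auto simp: ids trm_value_free_algebra[where \<sigma> = "\<lambda>x. Var (e x)"] term_class_eq_iff
      Id_on_iff wf_trm_subst term_class_in_free_algebra)

lemma congruence_renaming_kernel:
  assumes "identities ar \<Sigma>"
  shows "congruence ar (free_algebra ar \<Sigma>) (renaming_kernel ar \<Sigma> e)"
  unfolding renaming_kernel_def
  by (intro congruence_evaluation_kernel congruence_equality free_algebra_in_variety
      free_algebra_is_algebra assms term_class_in_free_algebra) simp

text \<open>If \<open>\<theta>\<close> does not notice the renaming on the values of the variables, it does not notice it on the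
  values of terms; and two terms that the renaming identifies have equal values after renaming.\<close>

lemma renaming_kernel_subset_evaluation_kernel:
  assumes ids: "identities ar \<Sigma>" and B: "B \<in> variety ar \<Sigma>" and \<nu>: "\<And>x. \<nu> x \<in> universe B"
    and \<theta>: "congruence ar B \<theta>" and e: "\<And>x. (\<nu> x, \<nu> (e x)) \<in> \<theta>"
  shows "renaming_kernel ar \<Sigma> e \<subseteq> evaluation_kernel ar \<Sigma> B \<nu> \<theta>"
proof (rule subrelI)
  fix C D assume CD: "(C, D) \<in> renaming_kernel ar \<Sigma> e"
  then obtain s t where st: "C = term_class ar \<Sigma> s" "D = term_class ar \<Sigma> t" "wf_trm ar s" "wf_trm ar t"
    unfolding renaming_kernel_def evaluation_kernel_def by blast
  have eq: "sym \<theta>" "trans \<theta>" using \<theta> by (auto simp: congruence_def elim: equivE)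
  let ?e = "subst (\<lambda>x. Var (e x))"
  have r: "(trm_value B \<nu> u, trm_value B \<nu> (?e u)) \<in> \<theta>" if "wf_trm ar u" for u
    unfolding trm_value_subst using that e by (intro congruence_trm_value[OF \<theta>]) auto
  have "derivable ar \<Sigma> (?e s) (?e t)" using CD st ids by (simp add: renaming_kernel_iff)
  then have "trm_value B \<nu> (?e s) = trm_value B \<nu> (?e t)" by (intro derivable_sound[OF B _ \<nu> ids])
  with r[OF st(3)] r[OF st(4)] eq have "(trm_value B \<nu> s, trm_value B \<nu> t) \<in> \<theta>"
    by (metis symD transD)
  with st show "(C, D) \<in> evaluation_kernel ar \<Sigma> B \<nu> \<theta>" by (simp add: evaluation_kernel_iff ids B \<nu>)
qed

lemma renaming_kernel_mono:
  assumes ids: "identities ar \<Sigma>" and e: "\<And>x. e' (e x) = e' x"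
  shows "renaming_kernel ar \<Sigma> e \<subseteq> renaming_kernel ar \<Sigma> e'"
proof (rule subrelI)
  fix C D assume CD: "(C, D) \<in> renaming_kernel ar \<Sigma> e"
  then obtain s t where st: "C = term_class ar \<Sigma> s" "D = term_class ar \<Sigma> t" "wf_trm ar s" "wf_trm ar t"
    unfolding renaming_kernel_def evaluation_kernel_def by blast
  have "derivable ar \<Sigma> (subst (\<lambda>x. Var (e x)) s) (subst (\<lambda>x. Var (e x)) t)"
    using CD st ids by (simp add: renaming_kernel_iff)
  from derivable_subst[OF this, of "\<lambda>x. Var (e' x)"] st ids show "(C, D) \<in> renaming_kernel ar \<Sigma> e'"
    by (simp add: renaming_kernel_iff subst_subst e)
qed

text \<open>The modular law, in terms of elements, for an algebra \<open>B\<close> of the variety over an arbitrary type,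
  although modularity is assumed only for algebras over the type of sets of terms. The elements of
  a chain of \<open>\<alpha>\<close>-steps and \<open>\<beta>\<close>-steps from \<open>u\<close> to \<open>v\<close> are used as the values of the variables. In the
  free algebra, let \<open>\<alpha>'\<close> and \<open>\<beta>'\<close> identify the generators that are linked by \<open>\<alpha>\<close>-steps and
  by \<open>\<beta>\<close>-steps, and let \<open>\<gamma>'\<close> identify, beyond \<open>\<alpha>'\<close>, the two ends of the chain.
  The pair of ends lies in the meet of \<open>\<gamma>'\<close> with the join of \<open>\<alpha>'\<close> and \<open>\<beta>'\<close>, hence by
  modularity in the join of \<open>\<alpha>'\<close> with \<open>\<beta>' \<inter> \<gamma>'\<close>. Both parts of the latter are contained in
  the pullback of \<open>\<theta>\<close>.\<close>

proposition modular_law_for_congruences: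
  assumes ids: "identities ar \<Sigma>" and cm: "congruence_modular TYPE(('f, nat) trm set) ar \<Sigma>"
    and B: "(B :: ('f, 'b) algebra) \<in> variety ar \<Sigma>"
    and con: "congruence ar B \<alpha>" "congruence ar B \<beta>" "congruence ar B \<gamma>" "congruence ar B \<theta>"
    and sub: "\<alpha> \<subseteq> \<gamma>" "\<alpha> \<subseteq> \<theta>" "\<beta> \<inter> \<gamma> \<subseteq> \<theta>"
    and uv: "(u, v) \<in> (\<alpha> \<union> \<beta>)\<^sup>*" "(u, v) \<in> \<gamma>"
  shows "(u, v) \<in> \<theta>"
proof -
  have eq: "equiv (universe B) \<alpha>" "equiv (universe B) \<beta>" "equiv (universe B) \<gamma>"
    using con by (auto simp: congruence_def)
  obtain n p where p: "p 0 = u" "p n = v" "\<And>i. i < n \<Longrightarrow> (p i, p (Suc i)) \<in> \<alpha> \<union> \<beta>"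
    using uv(1) by (metis rtrancl_imp_relpow relpow_fun_conv)
  have in_univ: "a \<in> universe B \<and> b \<in> universe B" if "(a, b) \<in> \<alpha> \<union> \<beta> \<union> \<gamma>" for a b
    using eq that by (auto simp: equiv_def)
  have p_in: "p i \<in> universe B" if "i \<le> n" for i
  proof (cases "i = n")
    case True then show ?thesis using in_univ[of u v] uv p by simp
  next
    case False then show ?thesis using in_univ[of "p i" "p (Suc i)"] p(3)[of i] that by auto
  qed
  \<comment> \<open>The chain is continued constantly beyond its end, so that every variable has a value.\<close>
  define \<nu> where "\<nu> x = p (min x n)" for x
  have \<nu>: "\<nu> x \<in> universe B" for x by (simp add: \<nu>_def p_in)
  have step: "(\<nu> x, \<nu> (Suc x)) \<in> \<alpha> \<union> \<beta>" for x
  proof (cases "x < n")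
    case True then show ?thesis using p(3)[of x] by (simp add: \<nu>_def min_def Suc_leI)
  next
    case False then show ?thesis using eq(1) p_in[of n] by (auto simp: \<nu>_def equiv_def refl_on_def)
  qed
  let ?F = "free_algebra ar \<Sigma>" and ?cls = "term_class ar \<Sigma>"
  define e where "e \<eta> = block_start (\<lambda>x. (\<nu> x, \<nu> (Suc x)) \<in> \<eta>)" for \<eta>
  \<comment> \<open>\<open>e\<^sub>\<gamma>\<close> merges the last block of \<open>\<alpha>\<close> into the first one, which starts at 0.\<close>
  define e\<^sub>\<gamma> where "e\<^sub>\<gamma> x = (if e \<alpha> x = e \<alpha> n then 0 else e \<alpha> x)" for x
  define K where "K = renaming_kernel ar \<Sigma>"
  define T where "T \<eta> = evaluation_kernel ar \<Sigma> B \<nu> \<eta>" for \<eta>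
  let ?C = "{\<theta>. congruence ar ?F \<theta>}"
  have K: "K e' \<in> ?C" for e' unfolding K_def by (simp add: congruence_renaming_kernel ids)
  have KVar: "(?cls (Var x), ?cls (Var y)) \<in> K e'" if "e' x = e' y" for x y e'
    using that unfolding K_def by (simp add: renaming_kernel_iff ids derivable.refl)
  have T: "T \<theta> \<in> ?C" unfolding T_def by (simp add: congruence_evaluation_kernel ids B \<nu> con)
  have T_Int: "T \<eta> \<inter> T \<eta>' \<subseteq> T (\<eta> \<inter> \<eta>')" for \<eta> \<eta>'
  proof (rule subrelI)
    fix C D assume CD: "(C, D) \<in> T \<eta> \<inter> T \<eta>'"
    then obtain s t where "C = ?cls s" "D = ?cls t" "wf_trm ar s" "wf_trm ar t"
      unfolding T_def evaluation_kernel_def by blast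
    with CD show "(C, D) \<in> T (\<eta> \<inter> \<eta>')" by (simp add: T_def evaluation_kernel_iff ids B \<nu>)
  qed
  have T_mono: "T \<eta> \<subseteq> T \<eta>'" if "\<eta> \<subseteq> \<eta>'" for \<eta> \<eta>'
    using that unfolding T_def evaluation_kernel_def by blast
  have e: "(\<nu> x, \<nu> (e \<alpha> x)) \<in> \<alpha>" "(\<nu> x, \<nu> (e \<beta> x)) \<in> \<beta>" for x
    unfolding e_def by (rule related_block_start[OF eq(1) \<nu>] related_block_start[OF eq(2) \<nu>])+
  have "(\<nu> x, \<nu> (e\<^sub>\<gamma> x)) \<in> \<gamma>" for x
  proof (cases "e \<alpha> x = e \<alpha> n")
    case True
    have "(\<nu> x, \<nu> (e \<alpha> n)) \<in> \<gamma>" "(\<nu> n, \<nu> (e \<alpha> n)) \<in> \<gamma>" using e(1)[of x] e(1)[of n] sub True by auto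
    moreover have "(\<nu> 0, \<nu> n) \<in> \<gamma>" using uv p by (simp add: \<nu>_def)
    ultimately show ?thesis using True eq(3) by (simp add: e\<^sub>\<gamma>_def) (meson equivE symD transD)
  next
    case False then show ?thesis using e(1)[of x] sub by (auto simp: e\<^sub>\<gamma>_def)
  qed
  then have KT: "K (e \<alpha>) \<subseteq> T \<alpha>" "K (e \<beta>) \<subseteq> T \<beta>" "K e\<^sub>\<gamma> \<subseteq> T \<gamma>"
    unfolding K_def T_def
    by (intro renaming_kernel_subset_evaluation_kernel[OF ids B \<nu>] con e; assumption)+
  have K\<alpha>\<gamma>: "K (e \<alpha>) \<subseteq> K e\<^sub>\<gamma>"
    unfolding K_def by (intro renaming_kernel_mono[OF ids]) (simp add: e\<^sub>\<gamma>_def e_def)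
  have "modular_lattice (Con ar ?F)"
    using cm free_algebra_in_variety[OF ids] by (simp add: congruence_modular_def)
  then have lat: "lattice (inclusion_order ?C)"
    and mod: "\<And>x y z. x \<in> ?C \<Longrightarrow> y \<in> ?C \<Longrightarrow> z \<in> ?C \<Longrightarrow> x \<subseteq> z \<Longrightarrow>
      x \<squnion>\<^bsub>inclusion_order ?C\<^esub> (y \<sqinter>\<^bsub>inclusion_order ?C\<^esub> z) =
      (x \<squnion>\<^bsub>inclusion_order ?C\<^esub> y) \<sqinter>\<^bsub>inclusion_order ?C\<^esub> z"
    unfolding modular_lattice_def Con_def
    by (auto simp: inclusion_order_def)
  have meet: "x \<sqinter>\<^bsub>inclusion_order ?C\<^esub> y = x \<inter> y" if "x \<in> ?C" "y \<in> ?C" for x y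
    using that by (intro inclusion_lattice_meet[OF lat]) (auto intro: congruence_Int)
  note join = inclusion_lattice_join[OF lat]
  let ?J = "K (e \<alpha>) \<squnion>\<^bsub>inclusion_order ?C\<^esub> K (e \<beta>)"
  have J: "?J \<in> ?C" by (rule join(1)[OF K K])
  have "(?cls (Var 0), ?cls (Var x)) \<in> ?J" for x
  proof (induction x)
    case 0
    then show ?case using join(2)[OF K K] KVar by blast
  next
    case (Suc x)
    have "e \<alpha> (Suc x) = e \<alpha> x \<or> e \<beta> (Suc x) = e \<beta> x" using step[of x] by (auto simp: e_def)
    then have "(?cls (Var x), ?cls (Var (Suc x))) \<in> K (e \<alpha>) \<union> K (e \<beta>)" using KVar by fastforce
    then have "(?cls (Var x), ?cls (Var (Suc x))) \<in> ?J" using join(2,3)[OF K K] by blast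
    moreover have "trans ?J" using J by (auto simp: congruence_def elim: equivE)
    ultimately show ?case using Suc by (meson transD)
  qed
  moreover have "(?cls (Var 0), ?cls (Var n)) \<in> K e\<^sub>\<gamma>" by (rule KVar) (simp add: e\<^sub>\<gamma>_def e_def)
  ultimately have "(?cls (Var 0), ?cls (Var n)) \<in>
      K (e \<alpha>) \<squnion>\<^bsub>inclusion_order ?C\<^esub> (K (e \<beta>) \<inter> K e\<^sub>\<gamma>)"
    using mod[OF K K K K\<alpha>\<gamma>] meet[OF J K] meet[OF K K] by auto
  also have "\<dots> \<subseteq> T \<theta>"
  proof (rule join(4))
    show "K (e \<alpha>) \<subseteq> T \<theta>" using KT(1) T_mono[OF sub(2)] by blast
    show "K (e \<beta>) \<inter> K e\<^sub>\<gamma> \<subseteq> T \<theta>" using KT(2,3) T_Int T_mono[OF sub(3)] by blast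
    show "K (e \<beta>) \<inter> K e\<^sub>\<gamma> \<in> ?C" using K by (auto intro: congruence_Int)
  qed (use K T in blast)+
  finally show ?thesis
    unfolding T_def using p by (simp add: evaluation_kernel_iff ids B \<nu>) (simp add: \<nu>_def)
qed

section \<open>Relation filters and their ideals\<close>

lemma relation_filterD:
  assumes "relation_filter S F"
  shows "R \<in> F \<Longrightarrow> R \<subseteq> S \<times> S" "R \<in> F \<Longrightarrow> R \<subseteq> R' \<Longrightarrow> R' \<subseteq> S \<times> S \<Longrightarrow> R' \<in> F"
    "R \<in> F \<Longrightarrow> R' \<in> F \<Longrightarrow> R \<inter> R' \<in> F" "S \<times> S \<in> F" "F \<noteq> {}"
proof -
  show "R \<in> F \<Longrightarrow> R \<subseteq> S \<times> S" using assms by (auto simp: relation_filter_def)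
  show up: "R \<in> F \<Longrightarrow> R \<subseteq> R' \<Longrightarrow> R' \<subseteq> S \<times> S \<Longrightarrow> R' \<in> F" for R R'
    using assms by (simp add: relation_filter_def)
  show "R \<in> F \<Longrightarrow> R' \<in> F \<Longrightarrow> R \<inter> R' \<in> F" "F \<noteq> {}"
    using assms by (simp_all add: relation_filter_def)
  obtain R where "R \<in> F" "R \<subseteq> S \<times> S" using assms by (auto simp: relation_filter_def)
  then show "S \<times> S \<in> F" by (rule up) simp
qed

lemma relation_filterI:
  assumes "S \<times> S \<in> F" "\<And>R. R \<in> F \<Longrightarrow> R \<subseteq> S \<times> S"
    "\<And>R R'. R \<in> F \<Longrightarrow> R \<subseteq> R' \<Longrightarrow> R' \<subseteq> S \<times> S \<Longrightarrow> R' \<in> F" "\<And>R R'. R \<in> F \<Longrightarrow> R' \<in> F \<Longrightarrow> R \<inter> R' \<in> F"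
  shows "relation_filter S F"
  unfolding relation_filter_def
proof (intro conjI ballI allI impI)
  show "F \<subseteq> Pow (S \<times> S)" by (rule subsetI, rule PowI, rule assms(2))
  show "F \<noteq> {}" using assms(1) by auto
qed (erule conjE, (rule assms(3); assumption), rule assms(4))

lemma relation_filter_Int:
  assumes F: "relation_filter S F" and G: "relation_filter S G"
  shows "relation_filter S (F \<inter> G)"
proof (rule relation_filterI)
  show "S \<times> S \<in> F \<inter> G" using relation_filterD(4)[OF F] relation_filterD(4)[OF G] by simp
  show "R' \<in> F \<inter> G" if "R \<in> F \<inter> G" "R \<subseteq> R'" "R' \<subseteq> S \<times> S" for R R'
    using relation_filterD(2)[OF F _ that(2,3)] relation_filterD(2)[OF G _ that(2,3)] that(1) by simp
  show "R \<inter> R' \<in> F \<inter> G" if "R \<in> F \<inter> G" "R' \<in> F \<inter> G" for R R'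
    using relation_filterD(3)[OF F] relation_filterD(3)[OF G] that by simp
qed (use relation_filterD(1)[OF F] in simp)

lemma relation_filter_filter_op:
  assumes F: "relation_filter S F"
  shows "relation_filter S (filter_op F)"
proof -
  have *: "R \<in> filter_op F \<longleftrightarrow> R\<inverse> \<in> F" for R
    unfolding filter_op_def by (metis converse_converse imageE imageI)
  show ?thesis
  proof (rule relation_filterI; unfold *)
    show "(S \<times> S)\<inverse> \<in> F" using relation_filterD(4)[OF F] by (simp add: converse_Times)
    show "R \<subseteq> S \<times> S" if "R\<inverse> \<in> F" for R using relation_filterD(1)[OF F that] by auto
    show "R'\<inverse> \<in> F" if "R\<inverse> \<in> F" "R \<subseteq> R'" "R' \<subseteq> S \<times> S" for R R'
    proof (rule relation_filterD(2)[OF F that(1)])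
      show "R\<inverse> \<subseteq> R'\<inverse>" using that(2) by simp
      show "R'\<inverse> \<subseteq> S \<times> S" using that(3) by auto
    qed
    show "(R \<inter> R')\<inverse> \<in> F" if "R\<inverse> \<in> F" "R'\<inverse> \<in> F" for R R'
      using relation_filterD(3)[OF F that] by (simp add: converse_Int)
  qed
qed

text \<open>The relations under consideration always form a filter base, so the generated filter is its upward
  closure; this makes compositions and operations of filters accessible to elementwise reasoning.\<close>

lemma Fg_filter_base:
  assumes ne: "B \<noteq> {}" and sub: "\<And>b. b \<in> B \<Longrightarrow> b \<subseteq> S \<times> S"
    and dir: "\<And>b b'. b \<in> B \<Longrightarrow> b' \<in> B \<Longrightarrow> \<exists>c \<in> B. c \<subseteq> b \<inter> b'"
  shows "Fg S B = {R. R \<subseteq> S \<times> S \<and> (\<exists>b \<in> B. b \<subseteq> R)}" "relation_filter S (Fg S B)"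
proof -
  let ?U = "{R. R \<subseteq> S \<times> S \<and> (\<exists>b \<in> B. b \<subseteq> R)}"
  have U: "relation_filter S ?U"
  proof (rule relation_filterI)
    show "S \<times> S \<in> ?U" using ne sub by blast
    show "R' \<in> ?U" if R: "R \<in> ?U" "R \<subseteq> R'" "R' \<subseteq> S \<times> S" for R R'
    proof -
      obtain b where "b \<in> B" "b \<subseteq> R" using R(1) by blast
      with R show ?thesis by (auto intro!: bexI[of _ b])
    qed
  next
    fix R R' assume "R \<in> ?U" "R' \<in> ?U"
    then obtain b b' where b: "b \<in> B" "b' \<in> B" "b \<subseteq> R" "b' \<subseteq> R'" "R \<subseteq> S \<times> S" by blast
    obtain c where c: "c \<in> B" "c \<subseteq> b \<inter> b'" using dir[OF b(1,2)] by blast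
    then have "c \<subseteq> R \<inter> R'" using b(3,4) by (meson Int_mono order_trans)
    with c(1) b(5) show "R \<inter> R' \<in> ?U" by auto
  qed auto
  show "Fg S B = ?U"
    unfolding Fg_def
  proof (rule hull_unique)
    show "B \<subseteq> ?U" using sub by blast
    show "?U \<subseteq> t" if "B \<subseteq> t" "relation_filter S t" for t
      using that relation_filterD(2)[OF that(2)] by blast
  qed (rule U)
  with U show "relation_filter S (Fg S B)" by simp
qed

lemma Fg_Id_on:
  shows "Fg S {Id_on S} = {R. Id_on S \<subseteq> R \<and> R \<subseteq> S \<times> S}" "relation_filter S (Fg S {Id_on S})"
proof -
  have "Id_on S \<subseteq> S \<times> S" by auto
  then show "relation_filter S (Fg S {Id_on S})" "Fg S {Id_on S} = {R. Id_on S \<subseteq> R \<and> R \<subseteq> S \<times> S}"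
    by (subst Fg_filter_base[of "{Id_on S}" S]; auto)+
qed

lemma filter_comp_base:
  assumes "relation_filter S F" "relation_filter S F'"
  shows "filter_comp S F F' = {R. R \<subseteq> S \<times> S \<and> (\<exists>r \<in> F. \<exists>r' \<in> F'. r O r' \<subseteq> R)}" (is ?eq)
    and "relation_filter S (filter_comp S F F')"
proof -
  let ?B = "{r O r' | r r'. r \<in> F \<and> r' \<in> F'}"
  have 1: "?B \<noteq> {}" using relation_filterD(5)[OF assms(1)] relation_filterD(5)[OF assms(2)] by blast
  have 2: "b \<subseteq> S \<times> S" if "b \<in> ?B" for b
    using that relation_filterD(1)[OF assms(1)] relation_filterD(1)[OF assms(2)] by blast
  have 3: "\<exists>c \<in> ?B. c \<subseteq> b \<inter> b'" if bs: "b \<in> ?B" "b' \<in> ?B" for b b'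
  proof -
    obtain r r' where b: "b = r O r'" "r \<in> F" "r' \<in> F'" using bs(1) by blast
    obtain q q' where b': "b' = q O q'" "q \<in> F" "q' \<in> F'" using bs(2) by blast
    have "r \<inter> q \<in> F" "r' \<inter> q' \<in> F'"
      using relation_filterD(3)[OF assms(1)] relation_filterD(3)[OF assms(2)] b b' by simp_all
    moreover have "(r \<inter> q) O (r' \<inter> q') \<subseteq> b \<inter> b'" unfolding b b' by blast
    ultimately show ?thesis by blast
  qed
  have *: "Fg S ?B = {R. R \<subseteq> S \<times> S \<and> (\<exists>b \<in> ?B. b \<subseteq> R)}" "relation_filter S (Fg S ?B)"
    by (rule Fg_filter_base; (rule 1 | rule 2 | rule 3); assumption)+
  show ?eq unfolding filter_comp_def *(1) by blast
  show "relation_filter S (filter_comp S F F')" unfolding filter_comp_def by (rule *(2))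
qed

lemma rel_operI:
  assumes "length as = length Rs" "length bs = length Rs"
    "\<And>i. i < length Rs \<Longrightarrow> (as ! i, bs ! i) \<in> Rs ! i"
  shows "(oper A f as, oper A f bs) \<in> rel_oper A f Rs"
  using assms unfolding rel_oper_def by blast

lemma rel_oper_subset:
  assumes "is_algebra ar A" "length Rs = ar f" "\<And>R. R \<in> set Rs \<Longrightarrow> R \<subseteq> universe A \<times> universe A"
  shows "rel_oper A f Rs \<subseteq> universe A \<times> universe A"
proof (rule subsetI)
  fix z assume "z \<in> rel_oper A f Rs"
  then obtain as bs where z: "z = (oper A f as, oper A f bs)" "length as = length Rs"
    "length bs = length Rs" "\<forall>i < length Rs. (as ! i, bs ! i) \<in> Rs ! i"
    unfolding rel_oper_def by blast
  then have "as ! i \<in> universe A \<and> bs ! i \<in> universe A" if "i < length Rs" for i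
    using assms(3)[of "Rs ! i"] that by fastforce
  with z have "set as \<subseteq> universe A" "set bs \<subseteq> universe A" by (auto simp: in_set_conv_nth)
  with z assms show "z \<in> universe A \<times> universe A" by (simp add: is_algebra_def)
qed

lemma rel_oper_mono:
  assumes "list_all2 (\<subseteq>) Rs Rs'"
  shows "rel_oper A f Rs \<subseteq> rel_oper A f Rs'"
proof (rule subsetI)
  have len: "length Rs = length Rs'" and sub: "\<forall>i < length Rs. Rs ! i \<subseteq> Rs' ! i"
    using assms by (auto simp: list_all2_conv_all_nth)
  fix z assume "z \<in> rel_oper A f Rs"
  then obtain as bs where "z = (oper A f as, oper A f bs)" "length as = length Rs"
    "length bs = length Rs" "\<forall>i < length Rs. (as ! i, bs ! i) \<in> Rs ! i"
    unfolding rel_oper_def by blast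
  moreover from this(4) sub have "\<forall>i < length Rs. (as ! i, bs ! i) \<in> Rs' ! i" by blast
  ultimately show "z \<in> rel_oper A f Rs'" unfolding rel_oper_def len by blast
qed

text \<open>Intersecting the arguments coordinatewise shows that the relations \<open>rel_oper A f Rs\<close> form a filter
  base.\<close>

lemma filter_oper_base:
  assumes "is_algebra ar A" "length Fs = ar f" "\<forall>F \<in> set Fs. relation_filter (universe A) F"
  shows "filter_oper A f Fs =
      {R. R \<subseteq> universe A \<times> universe A \<and> (\<exists>Rs. list_all2 (\<in>) Rs Fs \<and> rel_oper A f Rs \<subseteq> R)}" (is ?eq)
    and "relation_filter (universe A) (filter_oper A f Fs)"
proof -
  let ?B = "{rel_oper A f Rs | Rs. list_all2 (\<in>) Rs Fs}"
  have 1: "?B \<noteq> {}"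
  proof -
    have "list_all2 (\<in>) (map (\<lambda>F. universe A \<times> universe A) Fs) Fs"
      using assms(3) by (auto simp: list_all2_conv_all_nth intro: relation_filterD(4))
    then show ?thesis by blast
  qed
  have 2: "b \<subseteq> universe A \<times> universe A" if "b \<in> ?B" for b
  proof -
    from that obtain Rs where Rs: "b = rel_oper A f Rs" "list_all2 (\<in>) Rs Fs" by blast
    then have "R \<subseteq> universe A \<times> universe A" if "R \<in> set Rs" for R
      using assms(3) that relation_filterD(1)
      by (metis in_set_conv_nth list_all2_conv_all_nth nth_mem)
    with Rs show ?thesis using rel_oper_subset[OF assms(1)] assms(2) list_all2_lengthD by metis
  qed
  have 3: "\<exists>c \<in> ?B. c \<subseteq> b \<inter> b'" if bs: "b \<in> ?B" "b' \<in> ?B" for b b'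
  proof -
    obtain Rs where "b = rel_oper A f Rs" "list_all2 (\<in>) Rs Fs" using bs(1) by blast
    moreover obtain Rs' where "b' = rel_oper A f Rs'" "list_all2 (\<in>) Rs' Fs" using bs(2) by blast
    ultimately have Rs: "b = rel_oper A f Rs" "list_all2 (\<in>) Rs Fs"
      "b' = rel_oper A f Rs'" "list_all2 (\<in>) Rs' Fs" .
    then have len: "length Rs = length Fs" "length Rs' = length Fs" by (auto dest: list_all2_lengthD)
    let ?Qs = "map2 (\<inter>) Rs Rs'"
    have "list_all2 (\<in>) ?Qs Fs"
      using Rs assms(3) len by (auto simp: list_all2_conv_all_nth intro!: relation_filterD(3))
    moreover have "rel_oper A f ?Qs \<subseteq> b \<inter> b'"
      unfolding Rs using len by (intro Int_greatest rel_oper_mono) (auto simp: list_all2_conv_all_nth)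
    ultimately show ?thesis by blast
  qed
  have *: "Fg (universe A) ?B = {R. R \<subseteq> universe A \<times> universe A \<and> (\<exists>b \<in> ?B. b \<subseteq> R)}"
    "relation_filter (universe A) (Fg (universe A) ?B)"
    by (rule Fg_filter_base; (rule 1 | rule 2 | rule 3); assumption)+
  show ?eq unfolding filter_oper_def *(1) by blast
  show "relation_filter (universe A) (filter_oper A f Fs)" unfolding filter_oper_def by (rule *(2))
qed

text \<open>The order is reversed, so a join is an intersection.\<close>

lemma join_Fil_Rel:
  assumes "relation_filter S F" "relation_filter S G"
  shows "F \<squnion>\<^bsub>Fil_Rel S\<^esub> G = F \<inter> G"
  unfolding join_def sup_def
proof (rule some_equality)
  show l: "least (Fil_Rel S) (F \<inter> G) (Upper (Fil_Rel S) {F, G})"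
    using relation_filter_Int[OF assms] assms
    by (auto simp: least_def Upper_def Fil_Rel_def reverse_inclusion_order_def)
  show "H = F \<inter> G" if "least (Fil_Rel S) H (Upper (Fil_Rel S) {F, G})" for H
  proof (rule antisym)
    show "H \<subseteq> F \<inter> G" "F \<inter> G \<subseteq> H"
      using that l by (auto simp: least_def Fil_Rel_def reverse_inclusion_order_def)
  qed
qed

lemma lattice_ideal_Fil_Rel_iff:
  "lattice_ideal (Fil_Rel S) E \<longleftrightarrow> (\<forall>F \<in> E. relation_filter S F) \<and> E \<noteq> {} \<and>
    (\<forall>F \<in> E. \<forall>G. relation_filter S G \<longrightarrow> F \<subseteq> G \<longrightarrow> G \<in> E) \<and> (\<forall>F \<in> E. \<forall>G \<in> E. F \<inter> G \<in> E)"
proof -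
  have c: "carrier (Fil_Rel S) = {F. relation_filter S F}" "le (Fil_Rel S) = (\<supseteq>)"
    by (simp_all add: Fil_Rel_def reverse_inclusion_order_def)
  have j: "F \<squnion>\<^bsub>Fil_Rel S\<^esub> G = F \<inter> G" if "\<forall>F \<in> E. relation_filter S F" "F \<in> E" "G \<in> E" for F G
    using join_Fil_Rel that by blast
  show ?thesis
  proof (cases "\<forall>F \<in> E. relation_filter S F")
    case True
    then show ?thesis unfolding lattice_ideal_def c using j[OF True] by (auto simp: subset_iff)
  next
    case False
    then show ?thesis unfolding lattice_ideal_def c by blast
  qed
qed

text \<open>Since \<open>E\<close> is an ideal, the generated ideal \<open>ideal_comp S E E\<close> lies in \<open>E\<close> as soon as its generators
  do; and since \<open>filter_op\<close> is an involution, one inclusion suffices for \<open>E = ideal_op E\<close>.\<close>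

lemma superuniformity_iff:
  "superuniformity S E \<longleftrightarrow> lattice_ideal (Fil_Rel S) E \<and> Fg S {Id_on S} \<in> E \<and>
    (\<forall>F \<in> E. filter_op F \<in> E) \<and> (\<forall>F \<in> E. \<forall>G \<in> E. filter_comp S F G \<in> E)"
proof -
  have inv: "filter_op (filter_op F) = F" for F :: "'a rel set"
    by (simp add: filter_op_def image_comp)
  have "E = ideal_op E \<longleftrightarrow> (\<forall>F \<in> E. filter_op F \<in> E)"
  proof
    assume *: "\<forall>F \<in> E. filter_op F \<in> E"
    have "F \<in> ideal_op E" if "F \<in> E" for F
      using * that imageI[of "filter_op F" E filter_op] by (simp add: ideal_op_def inv)
    then show "E = ideal_op E" using * by (auto simp: ideal_op_def)
  qed (auto simp: ideal_op_def)
  moreover have "ideal_comp S E E \<subseteq> E \<longleftrightarrow> (\<forall>F \<in> E. \<forall>G \<in> E. filter_comp S F G \<in> E)"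
    if "lattice_ideal (Fil_Rel S) E"
  proof
    show "\<forall>F \<in> E. \<forall>G \<in> E. filter_comp S F G \<in> E" if "ideal_comp S E E \<subseteq> E"
    proof (intro ballI)
      fix F G assume "F \<in> E" "G \<in> E"
      then have "filter_comp S F G \<in> {filter_comp S F F' | F F'. F \<in> E \<and> F' \<in> E}" by blast
      also have "\<dots> \<subseteq> ideal_comp S E E" unfolding ideal_comp_def Ig_def by (rule hull_subset)
      finally show "filter_comp S F G \<in> E" using that by blast
    qed
    show "ideal_comp S E E \<subseteq> E" if "\<forall>F \<in> E. \<forall>G \<in> E. filter_comp S F G \<in> E"
      unfolding ideal_comp_def Ig_def
      by (rule hull_minimal) (use that \<open>lattice_ideal (Fil_Rel S) E\<close> in blast)+
  qed
  ultimately show ?thesis unfolding superuniformity_def by blast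
qed

lemma superuniformityD:
  assumes "superuniformity S E"
  shows "F \<in> E \<Longrightarrow> relation_filter S F" "F \<in> E \<Longrightarrow> relation_filter S G \<Longrightarrow> F \<subseteq> G \<Longrightarrow> G \<in> E"
    "F \<in> E \<Longrightarrow> G \<in> E \<Longrightarrow> F \<inter> G \<in> E" "Fg S {Id_on S} \<in> E" "F \<in> E \<Longrightarrow> filter_op F \<in> E"
    "F \<in> E \<Longrightarrow> G \<in> E \<Longrightarrow> filter_comp S F G \<in> E"
  using assms unfolding superuniformity_iff lattice_ideal_Fil_Rel_iff by blast+

lemma superuniformityI:
  assumes "\<And>F. F \<in> E \<Longrightarrow> relation_filter S F"
    "\<And>F G. F \<in> E \<Longrightarrow> relation_filter S G \<Longrightarrow> F \<subseteq> G \<Longrightarrow> G \<in> E"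
    "\<And>F G. F \<in> E \<Longrightarrow> G \<in> E \<Longrightarrow> F \<inter> G \<in> E" "Fg S {Id_on S} \<in> E" "\<And>F. F \<in> E \<Longrightarrow> filter_op F \<in> E"
    "\<And>F G. F \<in> E \<Longrightarrow> G \<in> E \<Longrightarrow> filter_comp S F G \<in> E"
  shows "superuniformity S E"
  unfolding superuniformity_iff lattice_ideal_Fil_Rel_iff
proof (intro conjI ballI allI impI)
  show "E \<noteq> {}" using assms(4) by auto
  show "G \<in> E" if "F \<in> E" "relation_filter S G" "F \<subseteq> G" for F G using assms(2)[OF that] .
qed (simp_all add: assms(1,3-6))

lemma compatible_superuniformity_Inter:
  assumes "X \<noteq> {}" "\<And>E. E \<in> X \<Longrightarrow> superuniformity (universe A) E \<and> compatible ar A E"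
  shows "superuniformity (universe A) (\<Inter>X) \<and> compatible ar A (\<Inter>X)"
proof
  have X: "superuniformity (universe A) E" if "E \<in> X" for E using assms(2) that by blast
  note D = superuniformityD[OF X]
  show "superuniformity (universe A) (\<Inter>X)"
  proof (rule superuniformityI)
    show "relation_filter (universe A) F" if "F \<in> \<Inter>X" for F using assms(1) that D(1) by blast
  qed (use D(2-) in \<open>auto 0 3\<close>)
  show "compatible ar A (\<Inter>X)"
    unfolding compatible_def
  proof (intro allI impI InterI)
    fix f Fs E assume "length Fs = ar f \<and> set Fs \<subseteq> \<Inter>X" "E \<in> X"
    moreover from this have "set Fs \<subseteq> E" by blast
    ultimately show "filter_oper A f Fs \<in> E" using assms(2) by (simp add: compatible_def)
  qed
qed

lemma compatible_superuniformity_top: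
  assumes "is_algebra ar A"
  defines "T \<equiv> {F. relation_filter (universe A) F}"
  shows "superuniformity (universe A) T \<and> compatible ar A T"
proof
  show "superuniformity (universe A) T"
    unfolding T_def
    by (rule superuniformityI)
      (auto intro: relation_filter_Int Fg_Id_on(2) relation_filter_filter_op filter_comp_base(2))
  show "compatible ar A T"
    unfolding compatible_def T_def using filter_oper_base(2)[OF assms(1)] by blast
qed

lemma lattice_SupUnif: "is_algebra ar A \<Longrightarrow> lattice (SupUnif ar A)"
  unfolding SupUnif_def
  using compatible_superuniformity_top[of ar A]
  by (intro lattice_inclusion_order[of "{F. relation_filter (universe A) F}"])
    (auto simp: superuniformityD(1) intro!: compatible_superuniformity_Inter[simplified] )

section \<open>Congruences induced on powers\<close>

text \<open>Families \<open>p\<close> and \<open>q\<close> over an index type that carries a filter \<open>\<Phi>\<close> are thought of as generalised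
  points of \<open>S\<close>. The relations that eventually hold between them form a filter, and \<open>p\<close> and \<open>q\<close> count as
  close with respect to a superuniformity if this filter is one of its members.\<close>

definition pair_filter :: "'a set \<Rightarrow> 'i filter \<Rightarrow> ('i \<Rightarrow> 'a) \<Rightarrow> ('i \<Rightarrow> 'a) \<Rightarrow> 'a rel set" where
  "pair_filter S \<Phi> p q = {R. R \<subseteq> S \<times> S \<and> (\<forall>\<^sub>F i in \<Phi>. (p i, q i) \<in> R)}"

text \<open>Every verification of closeness reduces to finding a member of \<open>E\<close> all of whose relations
  eventually hold; the pair filter then lies below it. That the two families eventually take their
  values in \<open>S\<close> follows, because \<open>S \<times> S\<close> belongs to every filter of relations on \<open>S\<close>.\<close>

lemma pair_filter_in_superuniformity:
  assumes E: "superuniformity S E" and F: "F \<in> E" "F \<subseteq> pair_filter S \<Phi> p q"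
  shows "pair_filter S \<Phi> p q \<in> E"
proof -
  have "relation_filter S (pair_filter S \<Phi> p q)"
  proof (rule relation_filterI)
    show "S \<times> S \<in> pair_filter S \<Phi> p q"
      using relation_filterD(4)[OF superuniformityD(1)[OF E F(1)]] F(2) by blast
  next
    fix R R' assume "R \<in> pair_filter S \<Phi> p q" "R \<subseteq> R'" "R' \<subseteq> S \<times> S"
    then show "R' \<in> pair_filter S \<Phi> p q" unfolding pair_filter_def by (auto elim: eventually_mono)
  next
    fix R R' assume "R \<in> pair_filter S \<Phi> p q" "R' \<in> pair_filter S \<Phi> p q"
    then show "R \<inter> R' \<in> pair_filter S \<Phi> p q" unfolding pair_filter_def by (auto intro: eventually_conj)
  qed (simp add: pair_filter_def)
  with E F show ?thesis by (intro superuniformityD(2)[OF E F(1)])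
qed

definition power_algebra :: "('f, 'a) algebra \<Rightarrow> ('f, 'i \<Rightarrow> 'a) algebra" where
  "power_algebra A = \<lparr>universe = {p. \<forall>i. p i \<in> universe A},
    oper = (\<lambda>f ps i. oper A f (map (\<lambda>p. p i) ps))\<rparr>"

lemma trm_value_power_algebra:
  "trm_value (power_algebra A) \<nu> t = (\<lambda>i. trm_value A (\<lambda>x. \<nu> x i) t)"
proof (induction t)
  case (App f ts)
  then have "map (\<lambda>p. p i) (map (trm_value (power_algebra A) \<nu>) ts) =
      map (trm_value A (\<lambda>x. \<nu> x i)) ts" for i by simp
  then show ?case by (simp add: power_algebra_def del: map_map)
qed simp

lemma is_algebra_power_algebra:
  assumes "is_algebra ar A"
  shows "is_algebra ar (power_algebra A)"
  unfolding is_algebra_def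
proof (intro allI impI)
  fix f ps assume ps: "length ps = ar f \<and> set ps \<subseteq> universe (power_algebra A)"
  then have "set (map (\<lambda>p. p i) ps) \<subseteq> universe A" for i by (auto simp: power_algebra_def)
  with ps assms show "oper (power_algebra A) f ps \<in> universe (power_algebra A)"
    by (simp add: power_algebra_def is_algebra_def)
qed

lemma power_algebra_in_variety:
  fixes A :: "('f, 'a) algebra"
  assumes "A \<in> variety ar \<Sigma>"
  shows "(power_algebra A :: ('f, 'i \<Rightarrow> 'a) algebra) \<in> variety ar \<Sigma>"
proof -
  have "is_algebra ar (power_algebra A :: ('f, 'i \<Rightarrow> 'a) algebra)"
    using assms by (intro is_algebra_power_algebra) (simp add: variety_def)
  moreover have "trm_value A (\<lambda>x. \<nu> x i) s = trm_value A (\<lambda>x. \<nu> x i) t"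
    if "(s, t) \<in> \<Sigma>" "range \<nu> \<subseteq> universe (power_algebra A)" for \<nu> :: "nat \<Rightarrow> 'i \<Rightarrow> 'a" and i s t
  proof -
    have "range (\<lambda>x. \<nu> x i) \<subseteq> universe A" using that(2) by (auto simp: power_algebra_def)
    with that(1) assms show ?thesis by (auto simp: variety_def)
  qed
  ultimately show ?thesis by (auto simp: variety_def trm_value_power_algebra)
qed

definition induced_rel :: "('f, 'a) algebra \<Rightarrow> 'i filter \<Rightarrow> 'a rel set set \<Rightarrow> ('i \<Rightarrow> 'a) rel" where
  "induced_rel A \<Phi> E = {(p, q). p \<in> universe (power_algebra A) \<and> q \<in> universe (power_algebra A) \<and>
     pair_filter (universe A) \<Phi> p q \<in> E}"

text \<open>Each closure property of a compatible superuniformity, applied to pair filters, is the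
  corresponding property of a congruence: the filter generated by the identity gives reflexivity,
  \<open>filter_op\<close> symmetry, \<open>filter_comp\<close> transitivity, and \<open>filter_oper\<close> compatibility. For the last one,
  finitely many relations that eventually hold, one for each argument, eventually hold together.\<close>

lemma congruence_induced_rel:
  fixes A :: "('f, 'a) algebra" and \<Phi> :: "'i filter"
  assumes A: "is_algebra ar A" and E: "superuniformity (universe A) E" "compatible ar A E"
  shows "congruence ar (power_algebra A) (induced_rel A \<Phi> E)"
proof -
  let ?S = "universe A" and ?P = "power_algebra A :: ('f, 'i \<Rightarrow> 'a) algebra"
  note D = superuniformityD[OF E(1)]
  note intro = pair_filter_in_superuniformity[OF E(1)]
  have "equiv (universe ?P) (induced_rel A \<Phi> E)"
  proof (rule equivI)
    show "induced_rel A \<Phi> E \<subseteq> universe ?P \<times> universe ?P" by (auto simp: induced_rel_def)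
    have "pair_filter ?S \<Phi> p p \<in> E" if "p \<in> universe ?P" for p
      using that by (intro intro[OF D(4)])
        (auto simp: Fg_Id_on pair_filter_def power_algebra_def intro!: always_eventually)
    then show "refl_on (universe ?P) (induced_rel A \<Phi> E)" by (auto simp: refl_on_def induced_rel_def)
    have "pair_filter ?S \<Phi> q p \<in> E" if "pair_filter ?S \<Phi> p q \<in> E" for p q
      using that by (intro intro[OF D(5)]) (auto simp: filter_op_def pair_filter_def)
    then show "sym (induced_rel A \<Phi> E)" by (auto simp: sym_def induced_rel_def)
    have "pair_filter ?S \<Phi> p r \<in> E" if pq: "pair_filter ?S \<Phi> p q \<in> E" "pair_filter ?S \<Phi> q r \<in> E" for p q r
    proof (rule intro[OF D(6)[OF pq]], rule subsetI)
      fix R assume "R \<in> filter_comp ?S (pair_filter ?S \<Phi> p q) (pair_filter ?S \<Phi> q r)"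
      then obtain s t where R: "R \<subseteq> ?S \<times> ?S" "s O t \<subseteq> R"
        and ev: "\<forall>\<^sub>F i in \<Phi>. (p i, q i) \<in> s" "\<forall>\<^sub>F i in \<Phi>. (q i, r i) \<in> t"
        using pq D(1) by (auto simp: filter_comp_base pair_filter_def)
      from ev have "\<forall>\<^sub>F i in \<Phi>. (p i, r i) \<in> R" by eventually_elim (use R in blast)
      with R show "R \<in> pair_filter ?S \<Phi> p r" by (simp add: pair_filter_def)
    qed
    then show "trans (induced_rel A \<Phi> E)" by (auto simp: trans_def induced_rel_def)
  qed
  moreover have "(oper ?P f ps, oper ?P f qs) \<in> induced_rel A \<Phi> E"
    if len: "length ps = ar f" and pq: "list_all2 (\<lambda>p q. (p, q) \<in> induced_rel A \<Phi> E) ps qs" for f ps qs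
  proof -
    have len': "length qs = length ps" using pq by (simp add: list_all2_lengthD)
    let ?Fs = "map2 (pair_filter ?S \<Phi>) ps qs"
    have F: "?Fs ! j \<in> E" if "j < length ps" for j
      using pq that len' by (auto simp: list_all2_conv_all_nth induced_rel_def)
    have Fs: "set ?Fs \<subseteq> E"
    proof
      fix H assume "H \<in> set ?Fs"
      then obtain j where "j < length ?Fs" "H = ?Fs ! j" by (metis in_set_conv_nth)
      with F[of j] show "H \<in> E" by simp
    qed
    with E(2) len len' have FE: "filter_oper A f ?Fs \<in> E" by (simp add: compatible_def)
    have "pair_filter ?S \<Phi> (oper ?P f ps) (oper ?P f qs) \<in> E"
    proof (rule intro[OF FE], rule subsetI)
      fix R assume "R \<in> filter_oper A f ?Fs"
      then obtain Rs where R: "R \<subseteq> ?S \<times> ?S" "list_all2 (\<in>) Rs ?Fs" "rel_oper A f Rs \<subseteq> R"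
        using filter_oper_base(1)[OF A, of ?Fs f] D(1) Fs len len' by (auto simp: subset_iff)
      have lenR: "length Rs = length ps" using R(2) len' by (auto dest: list_all2_lengthD)
      have "\<forall>\<^sub>F i in \<Phi>. ((ps ! j) i, (qs ! j) i) \<in> Rs ! j" if "j < length ps" for j
        using R(2) that len' by (auto simp: list_all2_conv_all_nth pair_filter_def)
      then have "\<forall>\<^sub>F i in \<Phi>. \<forall>j \<in> {..<length ps}. ((ps ! j) i, (qs ! j) i) \<in> Rs ! j"
        by (intro eventually_ball_finite) auto
      then have "\<forall>\<^sub>F i in \<Phi>. (oper ?P f ps i, oper ?P f qs i) \<in> rel_oper A f Rs"
      proof eventually_elim
        case (elim i)
        then show ?case
          unfolding power_algebra_def using len' lenR by (auto intro!: rel_operI)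
      qed
      with R show "R \<in> pair_filter ?S \<Phi> (oper ?P f ps) (oper ?P f qs)"
        by (auto simp: pair_filter_def elim: eventually_mono)
    qed
    moreover have "oper ?P f ps \<in> universe ?P" "oper ?P f qs \<in> universe ?P"
    proof -
      have P: "is_algebra ar ?P" using A by (rule is_algebra_power_algebra)
      have "set ps \<subseteq> universe ?P" "set qs \<subseteq> universe ?P"
        using pq len' by (auto simp: list_all2_conv_all_nth induced_rel_def in_set_conv_nth)
      then show "oper ?P f ps \<in> universe ?P" "oper ?P f qs \<in> universe ?P"
        using P len len' by (simp_all add: is_algebra_def)
    qed
    ultimately show ?thesis by (simp add: induced_rel_def)
  qed
  ultimately show ?thesis by (simp add: congruence_def)
qed

section \<open>The join of two superuniformities\<close>

lemma relpow_Suc_subset: "R \<subseteq> S \<times> S \<Longrightarrow> R ^^ Suc n \<subseteq> S \<times> S"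
  by (induction n) auto

lemma relpow_mono: "P \<subseteq> Q \<Longrightarrow> P ^^ n \<subseteq> Q ^^ n" for P Q :: "'a rel"
  by (induction n) auto

lemma relpow_mono_exponent:
  assumes "R \<subseteq> S \<times> S" "Id_on S \<subseteq> R" "n \<le> m"
  shows "R ^^ Suc n \<subseteq> R ^^ Suc m"
  using assms(3)
proof (induction m rule: dec_induct)
  case (step m)
  have "R ^^ Suc m \<subseteq> R ^^ Suc m O R"
  proof (rule subrelI)
    fix a b assume ab: "(a, b) \<in> R ^^ Suc m"
    then have "(b, b) \<in> R" using relpow_Suc_subset[OF assms(1), of m] assms(2) by blast
    with ab show "(a, b) \<in> R ^^ Suc m O R" by blast
  qed
  with step show ?case by simp
qed simp

lemma relpow_relcomp_shift: "(Q O P) ^^ Suc n = Q O ((P O Q) ^^ n) O P"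
  by (induction n) (simp_all add: O_assoc)

lemma converse_relpow: "(R ^^ n)\<inverse> = (R\<inverse>) ^^ n" for R :: "'a rel"
  by (induction n) (simp_all add: converse_relcomp relpow_commute)

lemma rel_oper_relcomp:
  "rel_oper A f (map (\<lambda>j. P j O Q j) js) \<subseteq> rel_oper A f (map P js) O rel_oper A f (map Q js)"
proof (rule subsetI)
  fix z assume "z \<in> rel_oper A f (map (\<lambda>j. P j O Q j) js)"
  then obtain as bs where z: "z = (oper A f as, oper A f bs)" "length as = length js"
    "length bs = length js" "\<forall>i < length js. (as ! i, bs ! i) \<in> P (js ! i) O Q (js ! i)"
    unfolding rel_oper_def by auto
  then have "\<forall>i < length js. \<exists>c. (as ! i, c) \<in> P (js ! i) \<and> (c, bs ! i) \<in> Q (js ! i)" by blast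
  then obtain c where c: "\<And>i. i < length js \<Longrightarrow> (as ! i, c i) \<in> P (js ! i) \<and> (c i, bs ! i) \<in> Q (js ! i)"
    by metis
  let ?cs = "map c [0..<length js]"
  have "(oper A f as, oper A f ?cs) \<in> rel_oper A f (map P js)"
    using z c by (intro rel_operI) simp_all
  moreover have "(oper A f ?cs, oper A f bs) \<in> rel_oper A f (map Q js)"
    using z c by (intro rel_operI) simp_all
  ultimately show "z \<in> rel_oper A f (map P js) O rel_oper A f (map Q js)" using z(1) by blast
qed

lemma rel_oper_relpow:
  "rel_oper A f (map (\<lambda>j. P j ^^ Suc n) js) \<subseteq> rel_oper A f (map P js) ^^ Suc n"
proof (induction n)
  case (Suc n)
  have "rel_oper A f (map (\<lambda>j. P j ^^ Suc (Suc n)) js) \<subseteq>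
      rel_oper A f (map (\<lambda>j. P j ^^ Suc n) js) O rel_oper A f (map P js)"
    using rel_oper_relcomp[of A f "\<lambda>j. P j ^^ Suc n" P js] by simp
  also have "\<dots> \<subseteq> rel_oper A f (map P js) ^^ Suc n O rel_oper A f (map P js)"
    using Suc by (rule relcomp_mono) simp
  finally show ?case by simp
qed simp

text \<open>These are the filters below some finite composition \<open>F \<circ> F' \<circ> \<dots> \<circ> F \<circ> F'\<close> with \<open>F \<in> \<alpha>\<close> and
  \<open>F' \<in> \<beta>\<close>. They form a compatible superuniformity above \<open>\<alpha>\<close> and \<open>\<beta>\<close>, so they contain
  the join of \<open>\<alpha>\<close> and \<open>\<beta>\<close>.\<close>

definition chain_filters :: "'a set \<Rightarrow> 'a rel set set \<Rightarrow> 'a rel set set \<Rightarrow> 'a rel set set" where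
  "chain_filters S \<alpha> \<beta> = {G. relation_filter S G \<and>
     (\<exists>F \<in> \<alpha>. \<exists>F' \<in> \<beta>. \<exists>n. \<forall>r \<in> F. \<forall>r' \<in> F'. (r O r') ^^ Suc n \<in> G)}"

text \<open>Intersecting with the filter generated by the identity leaves only reflexive relations in \<open>F\<close> and
  \<open>F'\<close>. Chains can then be prolonged, which allows several filters to be given a common length of
  chain.\<close>

lemma chain_filters_reflexive:
  assumes \<alpha>: "superuniformity S \<alpha>" and \<beta>: "superuniformity S \<beta>" and G: "G \<in> chain_filters S \<alpha> \<beta>"
  obtains F F' n where "F \<in> \<alpha>" "F' \<in> \<beta>" "\<forall>r \<in> F \<union> F'. Id_on S \<subseteq> r \<and> r \<subseteq> S \<times> S"
    "\<forall>m \<ge> n. \<forall>r \<in> F. \<forall>r' \<in> F'. (r O r') ^^ Suc m \<in> G"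
proof -
  obtain F F' n where F: "F \<in> \<alpha>" "F' \<in> \<beta>" and n: "\<forall>r \<in> F. \<forall>r' \<in> F'. (r O r') ^^ Suc n \<in> G"
    and G': "relation_filter S G"
    using G unfolding chain_filters_def by blast
  let ?D = "Fg S {Id_on S}"
  have D: "Id_on S \<subseteq> r \<and> r \<subseteq> S \<times> S" if "r \<in> ?D" for r using that by (simp add: Fg_Id_on)
  have "(r O r') ^^ Suc m \<in> G" if "m \<ge> n" "r \<in> F \<inter> ?D" "r' \<in> F' \<inter> ?D" for m r r'
  proof (rule relation_filterD(2)[OF G'])
    have rr': "r O r' \<subseteq> S \<times> S" "Id_on S \<subseteq> r O r'" using D[of r] D[of r'] that by blast+
    show "(r O r') ^^ Suc n \<in> G" using n that by blast
    show "(r O r') ^^ Suc n \<subseteq> (r O r') ^^ Suc m" by (rule relpow_mono_exponent[OF rr' that(1)])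
    show "(r O r') ^^ Suc m \<subseteq> S \<times> S" by (rule relpow_Suc_subset[OF rr'(1)])
  qed
  moreover have "F \<inter> ?D \<in> \<alpha>" "F' \<inter> ?D \<in> \<beta>"
    using F superuniformityD(3,4)[OF \<alpha>] superuniformityD(3,4)[OF \<beta>] by blast+
  ultimately show ?thesis using D by (intro that[of "F \<inter> ?D" "F' \<inter> ?D" n]) blast+
qed

lemma subset_chain_filters:
  assumes \<alpha>: "superuniformity S \<alpha>" and \<beta>: "superuniformity S \<beta>"
  shows "\<alpha> \<subseteq> chain_filters S \<alpha> \<beta>" "\<beta> \<subseteq> chain_filters S \<alpha> \<beta>"
proof -
  let ?D = "Fg S {Id_on S}"
  have D: "Id_on S \<subseteq> r \<and> r \<subseteq> S \<times> S" if "r \<in> ?D" for r using that by (simp add: Fg_Id_on)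
  show "\<alpha> \<subseteq> chain_filters S \<alpha> \<beta>"
  proof
    fix G assume G: "G \<in> \<alpha>"
    note G' = superuniformityD(1)[OF \<alpha> G]
    have "(r O r') ^^ Suc 0 \<in> G" if "r \<in> G" "r' \<in> ?D" for r r'
    proof (rule relation_filterD(2)[OF G' that(1)])
      have "r \<subseteq> S \<times> S" by (rule relation_filterD(1)[OF G' that(1)])
      then show "r \<subseteq> (r O r') ^^ Suc 0" "(r O r') ^^ Suc 0 \<subseteq> S \<times> S" using D[OF that(2)] by auto
    qed
    then show "G \<in> chain_filters S \<alpha> \<beta>"
      using G G' superuniformityD(4)[OF \<beta>] unfolding chain_filters_def by blast
  qed
  show "\<beta> \<subseteq> chain_filters S \<alpha> \<beta>"
  proof
    fix G assume G: "G \<in> \<beta>"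
    note G' = superuniformityD(1)[OF \<beta> G]
    have "(r' O r) ^^ Suc 0 \<in> G" if "r \<in> G" "r' \<in> ?D" for r r'
    proof (rule relation_filterD(2)[OF G' that(1)])
      have "r \<subseteq> S \<times> S" by (rule relation_filterD(1)[OF G' that(1)])
      then show "r \<subseteq> (r' O r) ^^ Suc 0" "(r' O r) ^^ Suc 0 \<subseteq> S \<times> S" using D[OF that(2)] by auto
    qed
    then show "G \<in> chain_filters S \<alpha> \<beta>"
      using G G' superuniformityD(4)[OF \<alpha>] unfolding chain_filters_def by blast
  qed
qed

text \<open>Chains can be concatenated, and a chain that is read backwards starts with a step of the other
  kind, which a reflexive step at each end corrects.\<close>

lemma superuniformity_chain_filters:
  assumes \<alpha>: "superuniformity S \<alpha>" and \<beta>: "superuniformity S \<beta>"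
  shows "superuniformity S (chain_filters S \<alpha> \<beta>)"
proof (rule superuniformityI)
  let ?J = "chain_filters S \<alpha> \<beta>"
  note D\<alpha> = superuniformityD[OF \<alpha>] and D\<beta> = superuniformityD[OF \<beta>]
  show rf: "relation_filter S G" if "G \<in> ?J" for G using that by (simp add: chain_filters_def)
  show "H \<in> ?J" if "G \<in> ?J" "relation_filter S H" "G \<subseteq> H" for G H
    using that unfolding chain_filters_def by blast
  show "Fg S {Id_on S} \<in> ?J" using subset_chain_filters(1)[OF \<alpha> \<beta>] D\<alpha>(4) by blast
  show "filter_op G \<in> ?J" if G: "G \<in> ?J" for G
  proof -
    obtain F F' n where F: "F \<in> \<alpha>" "F' \<in> \<beta>" and refl: "\<forall>r \<in> F \<union> F'. Id_on S \<subseteq> r \<and> r \<subseteq> S \<times> S"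
      and n: "\<forall>m \<ge> n. \<forall>r \<in> F. \<forall>r' \<in> F'. (r O r') ^^ Suc m \<in> G"
      by (rule chain_filters_reflexive[OF \<alpha> \<beta> G])
    have "(q O q') ^^ Suc (Suc n) \<in> filter_op G" if q: "q \<in> filter_op F" "q' \<in> filter_op F'" for q q'
    proof -
      obtain r r' where r: "r \<in> F" "q = r\<inverse>" "r' \<in> F'" "q' = r'\<inverse>"
        using q by (auto simp: filter_op_def)
      have rr: "Id_on S \<subseteq> r" "r \<subseteq> S \<times> S" "Id_on S \<subseteq> r'" "r' \<subseteq> S \<times> S" using refl r by blast+
      have sub: "(r O r') ^^ Suc n \<subseteq> S \<times> S" using rr
        by (intro relpow_Suc_subset) blast
      have "(r' O r) ^^ Suc (Suc n) \<in> G"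
      proof (rule relation_filterD(2)[OF rf[OF G]])
        show "(r O r') ^^ Suc n \<in> G" using n r by blast
        show "(r O r') ^^ Suc n \<subseteq> (r' O r) ^^ Suc (Suc n)"
          unfolding relpow_relcomp_shift[where Q = r' and P = r and n = "Suc n"]
          using sub rr by blast
        show "(r' O r) ^^ Suc (Suc n) \<subseteq> S \<times> S" using rr
          by (intro relpow_Suc_subset) blast
      qed
      then have "((r' O r) ^^ Suc (Suc n))\<inverse> \<in> filter_op G" by (simp only: filter_op_def imageI)
      then show ?thesis by (simp only: converse_relpow converse_relcomp r(2,4))
    qed
    then show ?thesis
      using D\<alpha>(5)[OF F(1)] D\<beta>(5)[OF F(2)] relation_filter_filter_op[OF rf[OF G]]
      unfolding chain_filters_def by blast
  qed
  fix G H assume G: "G \<in> ?J" and H: "H \<in> ?J"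
  obtain F F' n where F: "F \<in> \<alpha>" "F' \<in> \<beta>" and n: "\<forall>m \<ge> n. \<forall>r \<in> F. \<forall>r' \<in> F'. (r O r') ^^ Suc m \<in> G"
    by (rule chain_filters_reflexive[OF \<alpha> \<beta> G])
  obtain E E' k where E: "E \<in> \<alpha>" "E' \<in> \<beta>" and k: "\<forall>m \<ge> k. \<forall>r \<in> E. \<forall>r' \<in> E'. (r O r') ^^ Suc m \<in> H"
    by (rule chain_filters_reflexive[OF \<alpha> \<beta> H])
  have FE: "F \<inter> E \<in> \<alpha>" "F' \<inter> E' \<in> \<beta>" using F E D\<alpha>(3) D\<beta>(3) by blast+
  have "(r O r') ^^ Suc (max n k) \<in> G \<inter> H" if "r \<in> F \<inter> E" "r' \<in> F' \<inter> E'" for r r'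
    using n[rule_format, of "max n k" r r'] k[rule_format, of "max n k" r r'] that
    by (simp del: relpow.simps)
  then show "G \<inter> H \<in> ?J"
    using FE relation_filter_Int[OF rf[OF G] rf[OF H]] unfolding chain_filters_def by blast
  note base = filter_comp_base[OF rf[OF G] rf[OF H]]
  have "(r O r') ^^ Suc (Suc (n + k)) \<in> filter_comp S G H" if "r \<in> F \<inter> E" "r' \<in> F' \<inter> E'" for r r'
  proof -
    have "Suc (Suc (n + k)) = Suc n + Suc k" by simp
    then have eq: "(r O r') ^^ Suc (Suc (n + k)) = (r O r') ^^ Suc n O (r O r') ^^ Suc k"
      by (simp only: relpow_add)
    have GH: "(r O r') ^^ Suc n \<in> G" "(r O r') ^^ Suc k \<in> H"
      using n[rule_format, of n r r'] k[rule_format, of k r r'] that by simp_all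
    moreover have "(r O r') ^^ Suc n O (r O r') ^^ Suc k \<subseteq> S \<times> S"
      using relation_filterD(1)[OF rf[OF G] GH(1)] relation_filterD(1)[OF rf[OF H] GH(2)] by blast
    ultimately show ?thesis unfolding eq base by blast
  qed
  then show "filter_comp S G H \<in> ?J"
    using FE base(2) unfolding chain_filters_def by blast
qed

text \<open>Chains of equal length, one for each argument of an operation, are combined by applying the
  operation at each position.\<close>

lemma compatible_chain_filters:
  assumes A: "is_algebra ar A"
    and \<alpha>: "superuniformity (universe A) \<alpha>" "compatible ar A \<alpha>"
    and \<beta>: "superuniformity (universe A) \<beta>" "compatible ar A \<beta>"
  shows "compatible ar A (chain_filters (universe A) \<alpha> \<beta>)"
  unfolding compatible_def
proof (intro allI impI, elim conjE)
  let ?S = "universe A"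
  let ?J = "chain_filters ?S \<alpha> \<beta>"
  note D\<alpha> = superuniformityD[OF \<alpha>(1)] and D\<beta> = superuniformityD[OF \<beta>(1)]
  fix f Gs assume len: "length Gs = ar f" and Gs: "set Gs \<subseteq> ?J"
  have "\<exists>F F' n. F \<in> \<alpha> \<and> F' \<in> \<beta> \<and> (\<forall>m \<ge> n. \<forall>r \<in> F. \<forall>r' \<in> F'. (r O r') ^^ Suc m \<in> G)"
    if "G \<in> set Gs" for G
  proof -
    have "G \<in> ?J" using that Gs by blast
    then obtain F F' n where "F \<in> \<alpha>" "F' \<in> \<beta>"
      "\<forall>m \<ge> n. \<forall>r \<in> F. \<forall>r' \<in> F'. (r O r') ^^ Suc m \<in> G"
      by (rule chain_filters_reflexive[OF \<alpha>(1) \<beta>(1)])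
    then show ?thesis by (intro exI[of _ F] exI[of _ F'] exI[of _ n]) simp
  qed
  then obtain F F' n where F: "\<And>G. G \<in> set Gs \<Longrightarrow> F G \<in> \<alpha>" "\<And>G. G \<in> set Gs \<Longrightarrow> F' G \<in> \<beta>"
    and n: "\<And>G m r r'. G \<in> set Gs \<Longrightarrow> m \<ge> n G \<Longrightarrow> r \<in> F G \<Longrightarrow> r' \<in> F' G \<Longrightarrow> (r O r') ^^ Suc m \<in> G"
    by metis
  define N where "N = Max (insert 0 (n ` set Gs))"
  have N: "n G \<le> N" if "G \<in> set Gs" for G unfolding N_def using that by (intro Max_ge) auto
  have in\<alpha>: "filter_oper A f (map F Gs) \<in> \<alpha>" using \<alpha>(2) F(1) len by (simp add: compatible_def image_subset_iff)
  have in\<beta>: "filter_oper A f (map F' Gs) \<in> \<beta>" using \<beta>(2) F(2) len by (simp add: compatible_def image_subset_iff)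
  have rf: "\<forall>G \<in> set Gs. relation_filter ?S G" using Gs by (auto simp: chain_filters_def)
  note base = filter_oper_base[OF A len rf]
  have "(q O q') ^^ Suc N \<in> filter_oper A f Gs"
    if q: "q \<in> filter_oper A f (map F Gs)" "q' \<in> filter_oper A f (map F' Gs)" for q q'
  proof -
    have "q \<subseteq> ?S \<times> ?S \<and> (\<exists>Rs. list_all2 (\<in>) Rs (map F Gs) \<and> rel_oper A f Rs \<subseteq> q)"
      using q(1) filter_oper_base(1)[OF A, of "map F Gs" f] len F(1) D\<alpha>(1) by auto
    then obtain Rs where Rs: "q \<subseteq> ?S \<times> ?S" "list_all2 (\<in>) Rs (map F Gs)" "rel_oper A f Rs \<subseteq> q"
      by blast
    have "q' \<subseteq> ?S \<times> ?S \<and> (\<exists>Rs. list_all2 (\<in>) Rs (map F' Gs) \<and> rel_oper A f Rs \<subseteq> q')"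
      using q(2) filter_oper_base(1)[OF A, of "map F' Gs" f] len F(2) D\<beta>(1) by auto
    then obtain Rs' where Rs': "q' \<subseteq> ?S \<times> ?S" "list_all2 (\<in>) Rs' (map F' Gs)" "rel_oper A f Rs' \<subseteq> q'"
      by blast
    have l: "length Rs = length Gs" "length Rs' = length Gs" using Rs(2) Rs'(2) by (auto dest: list_all2_lengthD)
    let ?js = "[0..<length Gs]"
    let ?Ts = "map (\<lambda>j. (Rs ! j O Rs' ! j) ^^ Suc N) ?js"
    have "?Ts ! j \<in> Gs ! j" if "j < length Gs" for j
    proof -
      have "Rs ! j \<in> F (Gs ! j)" "Rs' ! j \<in> F' (Gs ! j)"
        using list_all2_nthD2[OF Rs(2), of j] list_all2_nthD2[OF Rs'(2), of j] that by simp_all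
      then show ?thesis
        using n[of "Gs ! j" N "Rs ! j" "Rs' ! j"] N[of "Gs ! j"] that by (simp del: relpow.simps)
    qed
    then have T: "list_all2 (\<in>) ?Ts Gs" by (simp add: list_all2_conv_all_nth del: relpow.simps)
    have "rel_oper A f ?Ts \<subseteq> rel_oper A f (map (\<lambda>j. Rs ! j O Rs' ! j) ?js) ^^ Suc N"
      by (rule rel_oper_relpow)
    also have "\<dots> \<subseteq> (q O q') ^^ Suc N"
    proof (rule relpow_mono)
      have eq: "map ((!) Rs) ?js = Rs" "map ((!) Rs') ?js = Rs'" using l by (metis map_nth)+
      show "rel_oper A f (map (\<lambda>j. Rs ! j O Rs' ! j) ?js) \<subseteq> q O q'"
        using rel_oper_relcomp[of A f "(!) Rs" "(!) Rs'" ?js] Rs(3) Rs'(3) unfolding eq by blast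
    qed
    finally have "rel_oper A f ?Ts \<subseteq> (q O q') ^^ Suc N" .
    moreover have "(q O q') ^^ Suc N \<subseteq> ?S \<times> ?S" using Rs(1) Rs'(1) by (intro relpow_Suc_subset) blast
    ultimately show ?thesis using T unfolding base(1) by blast
  qed
  then show "filter_oper A f Gs \<in> ?J"
    using in\<alpha> in\<beta> base(2) unfolding chain_filters_def by blast
qed

section \<open>The modular law for superuniformities\<close>

text \<open>An index is a pair of sequences \<open>x\<close> and \<open>y\<close>, read as the zigzag
  \<open>x 0, y 0, x 1, y 1, \<dots>\<close>. The filter \<open>\<Phi>\<close> is generated by the sets \<open>W\<close> of zigzags whose steps lie
  alternately in a relation of \<open>F\<close> and one of \<open>F'\<close> and whose ends are related by a member of \<open>G\<close>. The
  coordinate maps are then linked by steps of the two induced congruences. The filter of relations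
  between the ends is \<open>G\<close> itself, and not merely contains it: a relation that holds
  for the ends of all zigzags in \<open>W\<close> contains an intersection of two members of \<open>G\<close>.\<close>

lemma chain_filters_realised:
  assumes A: "universe A \<noteq> {}" and G: "G \<in> chain_filters (universe A) \<alpha> \<beta>"
    and \<alpha>: "superuniformity (universe A) \<alpha>" and \<beta>: "superuniformity (universe A) \<beta>"
  obtains \<Phi> :: "((nat \<Rightarrow> 'a) \<times> (nat \<Rightarrow> 'a)) filter" and u v :: "(nat \<Rightarrow> 'a) \<times> (nat \<Rightarrow> 'a) \<Rightarrow> 'a"
  where "u \<in> universe (power_algebra A)" "v \<in> universe (power_algebra A)"
    "pair_filter (universe A) \<Phi> u v = G" "(u, v) \<in> (induced_rel A \<Phi> \<alpha> \<union> induced_rel A \<Phi> \<beta>)\<^sup>*"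
proof -
  let ?S = "universe A"
  obtain F F' n where F: "F \<in> \<alpha>" "F' \<in> \<beta>" and n: "\<forall>r \<in> F. \<forall>r' \<in> F'. (r O r') ^^ Suc n \<in> G"
    and rG: "relation_filter ?S G"
    using G unfolding chain_filters_def by blast
  note rF = superuniformityD(1)[OF \<alpha> F(1)] and rF' = superuniformityD(1)[OF \<beta> F(2)]
  obtain s where s: "s \<in> ?S" using A by blast
  define W where "W = (\<lambda>(g, r, r'). {(x, y). (x 0, x (Suc n)) \<in> (g :: 'a rel) \<and>
    (\<forall>i \<le> n. (x i, y i) \<in> (r :: 'a rel) \<and> (y i, x (Suc i)) \<in> (r' :: 'a rel))})"
  define \<Phi> where "\<Phi> = (INF t \<in> G \<times> F \<times> F'. principal (W t))"
  have ev: "eventually P \<Phi> \<longleftrightarrow> (\<exists>g \<in> G. \<exists>r \<in> F. \<exists>r' \<in> F'. \<forall>z \<in> W (g, r, r'). P z)" for P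
  proof -
    have "eventually P \<Phi> \<longleftrightarrow> (\<exists>t \<in> G \<times> F \<times> F'. eventually P (principal (W t)))"
      unfolding \<Phi>_def
    proof (rule eventually_INF_base)
      show "G \<times> F \<times> F' \<noteq> {}" using rG rF rF' by (simp add: relation_filterD(5))
      fix t t' assume "t \<in> G \<times> F \<times> F'" "t' \<in> G \<times> F \<times> F'"
      moreover obtain g r r' h q q' where t: "t = (g, r, r')" "t' = (h, q, q')" by (metis prod_cases3)
      ultimately have "(g \<inter> h, r \<inter> q, r' \<inter> q') \<in> G \<times> F \<times> F'"
        using relation_filterD(3)[OF rG] relation_filterD(3)[OF rF] relation_filterD(3)[OF rF'] by simp
      moreover have "W (g \<inter> h, r \<inter> q, r' \<inter> q') \<subseteq> W t \<inter> W t'" by (auto simp: W_def t)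
      ultimately show "\<exists>x \<in> G \<times> F \<times> F'. principal (W x) \<le> inf (principal (W t)) (principal (W t'))"
        by (intro bexI[of _ "(g \<inter> h, r \<inter> q, r' \<inter> q')"]) simp_all
    qed
    then show ?thesis by (simp add: eventually_principal)
  qed
  \<comment> \<open>Elements of a power take all their values in the universe, but the sequences
    in an index may leave it. \<open>\<Phi>\<close> does not see such indices, so any default value will do.\<close>
  define c where "c a = (if a \<in> ?S then a else s)" for a
  define \<xi> where "\<xi> i z = c (fst z i)" for i and z :: "(nat \<Rightarrow> 'a) \<times> (nat \<Rightarrow> 'a)"
  define \<eta> where "\<eta> i z = c (snd z i)" for i and z :: "(nat \<Rightarrow> 'a) \<times> (nat \<Rightarrow> 'a)"
  have univ: "\<xi> i \<in> universe (power_algebra A)" "\<eta> i \<in> universe (power_algebra A)" for i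
    using s by (auto simp: \<xi>_def \<eta>_def c_def power_algebra_def)
  have c: "(c a, c b) \<in> R" if "(a, b) \<in> R" "R \<subseteq> ?S \<times> ?S" for a b R
    using that by (auto simp: c_def)
  have SS: "?S \<times> ?S \<in> G" "?S \<times> ?S \<in> F" "?S \<times> ?S \<in> F'" by (simp_all add: relation_filterD(4) rG rF rF')
  have sub\<alpha>: "F \<subseteq> pair_filter ?S \<Phi> (\<xi> i) (\<eta> i)" if "i \<le> n" for i
  proof
    fix R assume R: "R \<in> F"
    have "R \<subseteq> ?S \<times> ?S" by (rule relation_filterD(1)[OF rF R])
    moreover from this have "\<forall>z \<in> W (?S \<times> ?S, R, ?S \<times> ?S). (\<xi> i z, \<eta> i z) \<in> R"
      using that by (auto simp: W_def \<xi>_def \<eta>_def intro!: c)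
    ultimately show "R \<in> pair_filter ?S \<Phi> (\<xi> i) (\<eta> i)"
      unfolding pair_filter_def mem_Collect_eq ev using R SS by blast
  qed
  have sub\<beta>: "F' \<subseteq> pair_filter ?S \<Phi> (\<eta> i) (\<xi> (Suc i))" if "i \<le> n" for i
  proof
    fix R assume R: "R \<in> F'"
    have "R \<subseteq> ?S \<times> ?S" by (rule relation_filterD(1)[OF rF' R])
    moreover from this have "\<forall>z \<in> W (?S \<times> ?S, ?S \<times> ?S, R). (\<eta> i z, \<xi> (Suc i) z) \<in> R"
      using that by (auto simp: W_def \<xi>_def \<eta>_def intro!: c)
    ultimately show "R \<in> pair_filter ?S \<Phi> (\<eta> i) (\<xi> (Suc i))"
      unfolding pair_filter_def mem_Collect_eq ev using R SS by blast
  qed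
  let ?T = "induced_rel A \<Phi> \<alpha> \<union> induced_rel A \<Phi> \<beta>"
  have "(\<xi> 0, \<xi> i) \<in> ?T\<^sup>*" if "i \<le> Suc n" for i
    using that
  proof (induction i)
    case (Suc i)
    then have "(\<xi> i, \<eta> i) \<in> ?T" "(\<eta> i, \<xi> (Suc i)) \<in> ?T"
      using pair_filter_in_superuniformity[OF \<alpha> F(1) sub\<alpha>[of i]]
        pair_filter_in_superuniformity[OF \<beta> F(2) sub\<beta>[of i]] univ
      by (auto simp: induced_rel_def)
    with Suc show ?case by (meson Suc_leD rtrancl.rtrancl_into_rtrancl)
  qed simp
  moreover have "pair_filter ?S \<Phi> (\<xi> 0) (\<xi> (Suc n)) = G"
  proof (intro antisym subsetI)
    fix R assume R: "R \<in> G"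
    have "R \<subseteq> ?S \<times> ?S" by (rule relation_filterD(1)[OF rG R])
    moreover from this have "\<forall>z \<in> W (R, ?S \<times> ?S, ?S \<times> ?S). (\<xi> 0 z, \<xi> (Suc n) z) \<in> R"
      by (auto simp: W_def \<xi>_def intro!: c)
    ultimately show "R \<in> pair_filter ?S \<Phi> (\<xi> 0) (\<xi> (Suc n))"
      unfolding pair_filter_def mem_Collect_eq ev using R SS by blast
  next
    fix R assume "R \<in> pair_filter ?S \<Phi> (\<xi> 0) (\<xi> (Suc n))"
    then obtain g r r' where R: "R \<subseteq> ?S \<times> ?S" "g \<in> G" "r \<in> F" "r' \<in> F'"
      and W: "\<And>z. z \<in> W (g, r, r') \<Longrightarrow> (\<xi> 0 z, \<xi> (Suc n) z) \<in> R"
      unfolding pair_filter_def ev by blast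
    have "g \<inter> (r O r') ^^ Suc n \<subseteq> R"
    proof (rule subrelI)
      fix a b assume ab: "(a, b) \<in> g \<inter> (r O r') ^^ Suc n"
      then have "(a, b) \<in> (r O r') ^^ Suc n" by blast
      then obtain x where x: "x 0 = a" "x (Suc n) = b" "\<forall>i < Suc n. (x i, x (Suc i)) \<in> r O r'"
        unfolding relpow_fun_conv by blast
      have "\<exists>y. (x i, y) \<in> r \<and> (y, x (Suc i)) \<in> r'" if "i \<le> n" for i
      proof -
        have "(x i, x (Suc i)) \<in> r O r'" using x(3) that by simp
        then show ?thesis by blast
      qed
      then obtain y where "\<And>i. i \<le> n \<Longrightarrow> (x i, y i) \<in> r \<and> (y i, x (Suc i)) \<in> r'"
        by metis
      with x ab have "(\<xi> 0 (x, y), \<xi> (Suc n) (x, y)) \<in> R" by (intro W) (simp add: W_def)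
      moreover have "a \<in> ?S" "b \<in> ?S" using ab relation_filterD(1)[OF rG R(2)] by auto
      ultimately show "(a, b) \<in> R" using x by (simp add: \<xi>_def c_def)
    qed
    moreover have "(r O r') ^^ Suc n \<in> G" using n R by blast
    then have "g \<inter> (r O r') ^^ Suc n \<in> G" by (rule relation_filterD(3)[OF rG R(2)])
    ultimately show "R \<in> G" by (intro relation_filterD(2)[OF rG _ _ R(1)])
  qed
  ultimately show thesis using univ by (intro that[of "\<xi> 0" "\<xi> (Suc n)" \<Phi>]) simp_all
qed

lemma relation_filter_empty: "relation_filter {} F \<Longrightarrow> F = {{}}"
  using relation_filterD(1,4)[of "{}" F] by auto

text \<open>A member \<open>G\<close> of the left-hand side is the pair filter of the two ends of a chain in a power of \<open>A\<close>,
  and these ends are also related by the congruence that \<open>\<gamma>\<close> induces. The modular law for congruences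
  of the power relates them by the congruence that \<open>\<theta>\<close> induces, which says that \<open>G \<in> \<theta>\<close>.\<close>

proposition chain_filters_Int_subset:
  fixes A :: "('f, 'a) algebra"
  assumes ids: "identities ar \<Sigma>" and cm: "congruence_modular TYPE(('f, nat) trm set) ar \<Sigma>"
    and A: "A \<in> variety ar \<Sigma>"
    and sup: "\<And>E. E \<in> {\<alpha>, \<beta>, \<gamma>, \<theta>} \<Longrightarrow> superuniformity (universe A) E \<and> compatible ar A E"
    and sub: "\<alpha> \<subseteq> \<gamma>" "\<alpha> \<subseteq> \<theta>" "\<beta> \<inter> \<gamma> \<subseteq> \<theta>"
  shows "chain_filters (universe A) \<alpha> \<beta> \<inter> \<gamma> \<subseteq> \<theta>"
proof
  fix G assume G: "G \<in> chain_filters (universe A) \<alpha> \<beta> \<inter> \<gamma>"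
  have s: "superuniformity (universe A) \<alpha>" "superuniformity (universe A) \<beta>"
    "superuniformity (universe A) \<theta>" using sup by blast+
  show "G \<in> \<theta>"
  proof (cases "universe A = {}")
    case True
    \<comment> \<open>The power of the empty algebra has no elements, but there is only one filter to consider.\<close>
    then show ?thesis
      using G superuniformityD(1,4)[OF s(3)] relation_filter_empty
      unfolding chain_filters_def by (metis (mono_tags, lifting) IntD1 mem_Collect_eq)
  next
    case False
    obtain \<Phi> :: "((nat \<Rightarrow> 'a) \<times> (nat \<Rightarrow> 'a)) filter" and u v
      where uv: "u \<in> universe (power_algebra A)" "v \<in> universe (power_algebra A)"
        "pair_filter (universe A) \<Phi> u v = G" "(u, v) \<in> (induced_rel A \<Phi> \<alpha> \<union> induced_rel A \<Phi> \<beta>)\<^sup>*"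
      using chain_filters_realised[OF False _ s(1,2)] G by blast
    have con: "congruence ar (power_algebra A) (induced_rel A \<Phi> E)" if "E \<in> {\<alpha>, \<beta>, \<gamma>, \<theta>}" for E
      using congruence_induced_rel sup[OF that] A by (auto simp: variety_def)
    have "(u, v) \<in> induced_rel A \<Phi> \<theta>"
    proof (rule modular_law_for_congruences[OF ids cm power_algebra_in_variety[OF A]])
      show "induced_rel A \<Phi> \<alpha> \<subseteq> induced_rel A \<Phi> \<gamma>" "induced_rel A \<Phi> \<alpha> \<subseteq> induced_rel A \<Phi> \<theta>"
        "induced_rel A \<Phi> \<beta> \<inter> induced_rel A \<Phi> \<gamma> \<subseteq> induced_rel A \<Phi> \<theta>" using sub by (auto simp: induced_rel_def)
      show "(u, v) \<in> induced_rel A \<Phi> \<gamma>" using uv G by (simp add: induced_rel_def)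
    qed (use con uv in simp_all)
    then show ?thesis using uv by (simp add: induced_rel_def)
  qed
qed

theorem theorem3p25:
  fixes ar :: "'f \<Rightarrow> nat"
    and \<Sigma> :: "(('f, nat) trm \<times> ('f, nat) trm) set"
    and A :: "('f, 'a) algebra"
  assumes "identities ar \<Sigma>"
    and "congruence_modular TYPE(('f, nat) trm set) ar \<Sigma>"
    and "A \<in> variety ar \<Sigma>"
  shows "modular_lattice (SupUnif ar A)"
proof -
  let ?C = "{E. superuniformity (universe A) E \<and> compatible ar A E}"
  have A: "is_algebra ar A" using assms(3) by (simp add: variety_def)
  have lat: "lattice (inclusion_order ?C)" using lattice_SupUnif[OF A] by (simp add: SupUnif_def)
  have meet: "x \<sqinter>\<^bsub>inclusion_order ?C\<^esub> y = x \<inter> y" and Int: "x \<inter> y \<in> ?C" if "x \<in> ?C" "y \<in> ?C" for x y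
  proof -
    show "x \<inter> y \<in> ?C" using compatible_superuniformity_Inter[of "{x, y}" A ar] that by auto
    then show "x \<sqinter>\<^bsub>inclusion_order ?C\<^esub> y = x \<inter> y" using that by (intro inclusion_lattice_meet[OF lat])
  qed
  note join = inclusion_lattice_join[OF lat]
  have "x \<squnion>\<^bsub>inclusion_order ?C\<^esub> (y \<sqinter>\<^bsub>inclusion_order ?C\<^esub> z) =
      (x \<squnion>\<^bsub>inclusion_order ?C\<^esub> y) \<sqinter>\<^bsub>inclusion_order ?C\<^esub> z"
    if xyz: "x \<in> ?C" "y \<in> ?C" "z \<in> ?C" "x \<subseteq> z" for x y z
  proof -
    let ?xy = "x \<squnion>\<^bsub>inclusion_order ?C\<^esub> y" and ?w = "x \<squnion>\<^bsub>inclusion_order ?C\<^esub> (y \<inter> z)"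
    note xy = join[OF xyz(1,2)] and w = join[OF xyz(1) Int[OF xyz(2,3)]]
    have "?w = ?xy \<inter> z"
    proof (rule antisym)
      show "?w \<subseteq> ?xy \<inter> z" using xy(2,3) xyz(4) by (intro w(4) Int xy(1) xyz) blast+
      have "chain_filters (universe A) x y \<in> ?C"
        using superuniformity_chain_filters compatible_chain_filters[OF A] xyz by blast
      then have "?xy \<subseteq> chain_filters (universe A) x y"
        using subset_chain_filters xyz by (intro xy(4)) blast+
      moreover have "chain_filters (universe A) x y \<inter> z \<subseteq> ?w"
        using xyz w by (intro chain_filters_Int_subset[OF assms]) auto
      ultimately show "?xy \<inter> z \<subseteq> ?w" by blast
    qed
    then show ?thesis using meet xyz xy(1) by simp
  qed
  then show ?thesis
    using lat unfolding modular_lattice_def SupUnif_def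
    by (auto simp: inclusion_order_def)
qed

end
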